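(* For positive integers $n,k,q$, let $BS_q(n,k)$ denote the maximum of $BS_q(M)$ over all finite structures $M$ of order $n$ whose vocabulary has maximum relation arity $k$. Then $$BS_k(n,k)<n-\sqrt n+k^2+k.$$ On the other hand, if $n$ is a perfect square, then $BS_q(n,k)\ge n-(q-1)\sqrt n+q$ for every $q\ge2$ and $k\ge2$.
   Context: A vocabulary $L$ is a finite list of relation symbols with positive integer arities; maximum relation arity = largest arity. An $L$-structure $M$ has a finite universe $V(M)$ and relations $R^M:V(M)^l\to\{0,1\}$; its order is $|V(M)|$. A Bernays–Schönfinkel formula is a first-order formula over $L\cup\{=\}$ of the form $\exists y_1\ldots\exists y_p\forall x_1\ldots\forall x_r\,\Psi$ with $p,r\ge0$ and $\Psi$ quantifier-free. A closed formula identifies $M$ of order $n$ if it is true on $M$ and false on every $L$-structure of order $n$ not isomorphic to $M$. $BS_q(M)$ is the minimum total number of quantifiers $p+r$ in a Bernays–Schönfinkel formula with $r\le q$ universal quantifiers that identifies $M$.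
   Formalization: The first bound is stated only for k ≥ 2 or n < 4 (it fails for k = 1, n ≥ 4: n elements with distinct unary colours need n quantifiers), and the second only for n > 1 (for n = 1 the right side is 2 but one quantifier suffices). *)

theory Defs
  imports Complex_Main
begin

text \<open>A vocabulary is the list of the arities of its relation symbols; the symbols are the
  positions \<open>i < length L\<close> of the list.\<close>

definition vocabulary :: "nat list \<Rightarrow> bool" where
  "vocabulary L \<longleftrightarrow> (\<forall>l \<in> set L. 0 < l)"

definition has_max_arity :: "nat list \<Rightarrow> nat \<Rightarrow> bool" where
  "has_max_arity L k \<longleftrightarrow> L \<noteq> [] \<and> Max (set L) = k"

text \<open>\<open>rel M i\<close> is only meaningful on lists over \<open>universe M\<close> whose length is the arity of
  symbol \<open>i\<close>; values elsewhere are never inspected.\<close>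

record 'a struct =
  universe :: "'a set"
  rel :: "nat \<Rightarrow> 'a list \<Rightarrow> bool"

definition has_order :: "'a struct \<Rightarrow> nat \<Rightarrow> bool" where
  "has_order M n \<longleftrightarrow> finite (universe M) \<and> card (universe M) = n"

definition isomorphic :: "nat list \<Rightarrow> 'a struct \<Rightarrow> 'b struct \<Rightarrow> bool" where
  "isomorphic L M N \<longleftrightarrow>
    (\<exists>f. bij_betw f (universe M) (universe N) \<and>
      (\<forall>i < length L. \<forall>as. length as = L ! i \<and> set as \<subseteq> universe M \<longrightarrow>
        rel M i as = rel N i (map f as)))"

datatype fm =
    Bot
  | Eq nat nat
  | Rel nat "nat list"
  | Neg fm
  | And fm fm
  | Or fm fm
  | Ex nat fm
  | All nat fm

fun fm_over :: "nat list \<Rightarrow> fm \<Rightarrow> bool" where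
  "fm_over L Bot \<longleftrightarrow> True"
| "fm_over L (Eq x y) \<longleftrightarrow> True"
| "fm_over L (Rel i xs) \<longleftrightarrow> i < length L \<and> length xs = L ! i"
| "fm_over L (Neg \<phi>) \<longleftrightarrow> fm_over L \<phi>"
| "fm_over L (And \<phi> \<psi>) \<longleftrightarrow> fm_over L \<phi> \<and> fm_over L \<psi>"
| "fm_over L (Or \<phi> \<psi>) \<longleftrightarrow> fm_over L \<phi> \<and> fm_over L \<psi>"
| "fm_over L (Ex x \<phi>) \<longleftrightarrow> fm_over L \<phi>"
| "fm_over L (All x \<phi>) \<longleftrightarrow> fm_over L \<phi>"

fun free_vars :: "fm \<Rightarrow> nat set" where
  "free_vars Bot = {}"
| "free_vars (Eq x y) = {x, y}"
| "free_vars (Rel i xs) = set xs"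
| "free_vars (Neg \<phi>) = free_vars \<phi>"
| "free_vars (And \<phi> \<psi>) = free_vars \<phi> \<union> free_vars \<psi>"
| "free_vars (Or \<phi> \<psi>) = free_vars \<phi> \<union> free_vars \<psi>"
| "free_vars (Ex x \<phi>) = free_vars \<phi> - {x}"
| "free_vars (All x \<phi>) = free_vars \<phi> - {x}"

fun quantifier_free :: "fm \<Rightarrow> bool" where
  "quantifier_free Bot \<longleftrightarrow> True"
| "quantifier_free (Eq x y) \<longleftrightarrow> True"
| "quantifier_free (Rel i xs) \<longleftrightarrow> True"
| "quantifier_free (Neg \<phi>) \<longleftrightarrow> quantifier_free \<phi>"
| "quantifier_free (And \<phi> \<psi>) \<longleftrightarrow> quantifier_free \<phi> \<and> quantifier_free \<psi>"
| "quantifier_free (Or \<phi> \<psi>) \<longleftrightarrow> quantifier_free \<phi> \<and> quantifier_free \<psi>"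
| "quantifier_free (Ex x \<phi>) \<longleftrightarrow> False"
| "quantifier_free (All x \<phi>) \<longleftrightarrow> False"

fun sat :: "'a struct \<Rightarrow> (nat \<Rightarrow> 'a) \<Rightarrow> fm \<Rightarrow> bool" where
  "sat M e Bot \<longleftrightarrow> False"
| "sat M e (Eq x y) \<longleftrightarrow> e x = e y"
| "sat M e (Rel i xs) \<longleftrightarrow> rel M i (map e xs)"
| "sat M e (Neg \<phi>) \<longleftrightarrow> \<not> sat M e \<phi>"
| "sat M e (And \<phi> \<psi>) \<longleftrightarrow> sat M e \<phi> \<and> sat M e \<psi>"
| "sat M e (Or \<phi> \<psi>) \<longleftrightarrow> sat M e \<phi> \<or> sat M e \<psi>"
| "sat M e (Ex x \<phi>) \<longleftrightarrow> (\<exists>a \<in> universe M. sat M (e(x := a)) \<phi>)"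
| "sat M e (All x \<phi>) \<longleftrightarrow> (\<forall>a \<in> universe M. sat M (e(x := a)) \<phi>)"

text \<open>For closed formulas the assignment is irrelevant.\<close>

definition true_on :: "'a struct \<Rightarrow> fm \<Rightarrow> bool" where
  "true_on M \<phi> \<longleftrightarrow> (\<forall>e. sat M e \<phi>)"

text \<open>\<open>bs_formula L p r \<phi>\<close>: \<open>\<phi>\<close> is a closed Bernays--Schoenfinkel formula over \<open>L\<close> with
  \<open>p\<close> existential and \<open>r\<close> universal quantifiers.\<close>

definition bs_formula :: "nat list \<Rightarrow> nat \<Rightarrow> nat \<Rightarrow> fm \<Rightarrow> bool" where
  "bs_formula L p r \<phi> \<longleftrightarrow>
    fm_over L \<phi> \<and> free_vars \<phi> = {} \<and>
    (\<exists>ys xs \<psi>. length ys = p \<and> length xs = r \<and> distinct (ys @ xs) \<and>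
      quantifier_free \<psi> \<and> \<phi> = foldr Ex ys (foldr All xs \<psi>))"

text \<open>Every finite structure has an isomorphic copy inside the natural numbers, so letting the
  competitors \<open>N\<close> have such universes loses nothing.\<close>

definition identifies :: "nat list \<Rightarrow> fm \<Rightarrow> 'a struct \<Rightarrow> bool" where
  "identifies L \<phi> M \<longleftrightarrow>
    true_on M \<phi> \<and>
    (\<forall>N :: nat struct. has_order N (card (universe M)) \<and> \<not> isomorphic L M N \<longrightarrow>
      \<not> true_on N \<phi>)"

definition BS :: "nat \<Rightarrow> nat list \<Rightarrow> 'a struct \<Rightarrow> nat" where
  "BS q L M =
    (LEAST m. \<exists>p r \<phi>. m = p + r \<and> r \<le> q \<and> bs_formula L p r \<phi> \<and> identifies L \<phi> M)"

text \<open>The minimum and the maximum below exist for \<open>n, k \<ge> 1\<close>: a purely existential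
  formula that names all \<open>n\<close> elements identifies \<open>M\<close>, so \<open>BS q L M \<le> n\<close>.\<close>

definition BS_max :: "nat \<Rightarrow> nat \<Rightarrow> nat \<Rightarrow> nat" where
  "BS_max q n k =
    Max {BS q L M | L (M :: nat struct).
          vocabulary L \<and> has_max_arity L k \<and> has_order M n}"

end

theory Submission
  imports Defs "HOL-Combinatorics.Permutations"
begin

text \<open>
  A formula with \<open>r\<close> universal quantifiers identifies \<open>M\<close> only if its existential quantifiers can
  name a set \<open>S\<close> that determines \<open>M\<close> in the following sense: \<open>M\<close> is the only structure \<open>N\<close> of its
  order in which any \<open>r\<close> elements, together with fixed counterparts of \<open>S\<close>, look as some elements
  of \<open>M\<close> do together with \<open>S\<close>.  Conversely, such an \<open>S\<close> yields an identifying formula with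
  \<open>card S\<close> existential quantifiers.

  Upper bound.  The complement of a set \<open>U\<close> determines \<open>M\<close> with \<open>k\<close> universal quantifiers if the
  elements of \<open>U\<close> have pairwise different types over that complement, and also if all permutations
  of \<open>U\<close> are automorphisms.  So it suffices to find such a \<open>U\<close> with more than \<open>s = sqrt n - k\<^sup>2\<close>
  elements.  If some \<open>X\<close> has more than \<open>s\<close> types over it, take one representative of each.
  Otherwise start from the empty set and repeat \<open>k - 1\<close> times: add blocks of at most \<open>k - 1\<close>
  elements as long as this increases the number of types, then add all type classes with at most
  \<open>k - 1\<close> elements.  Afterwards no set of \<open>k - 1\<close> elements separates two elements of one class, and
  as at most \<open>2(k - 1)\<^sup>2 s\<close> elements were used, some class has more than \<open>s + 1\<close> elements.

  Lower bound.  Take \<open>m\<close> disjoint cliques on \<open>m\<close> vertices each.  If \<open>r\<close> vertices of one clique are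
  not named by the existential quantifiers, then \<open>r\<close> universal quantifiers do not notice that an
  unnamed vertex of another clique is moved into it; a single one does not notice that the edge
  between two unnamed vertices is deleted.
\<close>

subsection \<open>Extending maps between finite sets\<close>

lemma ex_image_between:
  assumes "finite B" "finite X" "card B \<le> card X" "B \<subseteq> V" "V \<noteq> {}"
  shows "\<exists>b. B \<subseteq> b ` X \<and> b ` X \<subseteq> V"
proof -
  obtain c where "c \<in> V" using assms(5) by blast
  obtain h where h: "h ` B \<subseteq> X" "inj_on h B" using card_le_inj[OF assms(1-3)] by blast
  define b where "b x = (if x \<in> h ` B then inv_into B h x else c)" for x
  have "b (h y) = y" if "y \<in> B" for y using that h(2) by (simp add: b_def)
  then have "B \<subseteq> b ` X" using h(1) by force
  moreover have "b ` X \<subseteq> V"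
    using \<open>c \<in> V\<close> assms(4) by (auto simp: b_def intro: inv_into_into subsetD)
  ultimately show ?thesis by blast
qed

lemma ex_bij_betw_extending:
  assumes "finite A" "finite B" "card A = card B" and f: "inj_on f T" "T \<subseteq> A" "f ` T \<subseteq> B"
  shows "\<exists>g. bij_betw g A B \<and> (\<forall>x \<in> T. g x = f x)"
proof -
  have "card (A - T) = card (B - f ` T)"
    using assms by (simp add: card_Diff_subset card_image finite_subset)
  then obtain h where h: "bij_betw h (A - T) (B - f ` T)"
    using assms(1,2) by (metis finite_Diff finite_same_card_bij)
  have "bij_betw (override_on h f T) T (f ` T)"
    using f(1) by (auto simp: bij_betw_def inj_on_def)
  moreover have "bij_betw (override_on h f T) (A - T) (B - f ` T)"
    using h by (rule bij_betw_cong[THEN iffD1, rotated]) simp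
  ultimately have "bij_betw (override_on h f T) (T \<union> (A - T)) (f ` T \<union> (B - f ` T))"
    by (rule bij_betw_combine) blast
  moreover have "T \<union> (A - T) = A" "f ` T \<union> (B - f ` T) = B" using f(2,3) by auto
  ultimately show ?thesis by (intro exI[of _ "override_on h f T"]) simp
qed

lemma ex_permutes_extending:
  assumes "finite C" "inj_on f A" "A \<subseteq> C" "f ` A \<subseteq> C"
  shows "\<exists>\<pi>. \<pi> permutes C \<and> (\<forall>x \<in> A. \<pi> x = f x)"
proof -
  obtain g where g: "bij_betw g C C" "\<forall>x \<in> A. g x = f x"
    using ex_bij_betw_extending[OF assms(1,1) refl assms(2-)] by blast
  then show ?thesis
    using permutes_restrict_id[OF g(1)] assms(3) by (intro exI[of _ "restrict_id g C"]) auto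
qed

subsection \<open>Partial embeddings\<close>

definition partial_embedding ::
  "nat list \<Rightarrow> 'a struct \<Rightarrow> 'b struct \<Rightarrow> 'a set \<Rightarrow> ('a \<Rightarrow> 'b) \<Rightarrow> bool" where
  "partial_embedding L M N D f \<longleftrightarrow> inj_on f D \<and> f ` D \<subseteq> universe N \<and>
    (\<forall>i < length L. \<forall>w. length w = L ! i \<and> set w \<subseteq> D \<longrightarrow> rel M i w = rel N i (map f w))"

lemma partial_embedding_rel:
  "partial_embedding L M N D f \<Longrightarrow> i < length L \<Longrightarrow> length w = L ! i \<Longrightarrow> set w \<subseteq> D \<Longrightarrow>
    rel N i (map f w) = rel M i w"
  by (simp add: partial_embedding_def)

lemma partial_embedding_subset:
  "partial_embedding L M N E f \<Longrightarrow> D \<subseteq> E \<Longrightarrow> partial_embedding L M N D f"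
  unfolding partial_embedding_def by (meson image_mono inj_on_subset order_trans)

lemma partial_embedding_cong:
  assumes "\<And>x. x \<in> D \<Longrightarrow> f x = g x"
  shows "partial_embedding L M N D f \<longleftrightarrow> partial_embedding L M N D g"
proof -
  have "map f w = map g w" if "set w \<subseteq> D" for w using assms that by auto
  moreover have "inj_on f D \<longleftrightarrow> inj_on g D" using assms by (rule inj_on_cong)
  moreover have "f ` D = g ` D" using assms by (rule image_cong[OF refl])
  ultimately show ?thesis unfolding partial_embedding_def by metis
qed

lemma partial_embedding_comp:
  assumes "partial_embedding L M N D f" "partial_embedding L N K E g" "f ` D \<subseteq> E"
  shows "partial_embedding L M K D (g \<circ> f)"
  unfolding partial_embedding_def
proof (intro conjI allI impI; (elim conjE)?)
  show "inj_on (g \<circ> f) D"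
    using assms by (auto simp: partial_embedding_def intro: comp_inj_on inj_on_subset)
  show "(g \<circ> f) ` D \<subseteq> universe K"
    using assms unfolding partial_embedding_def image_comp[symmetric]
    by (meson image_mono order_trans)
  fix i w assume w: "i < length L" "length w = L ! i" "set w \<subseteq> D"
  then have "set (map f w) \<subseteq> E" using assms(3) by auto
  then show "rel M i w = rel K i (map (g \<circ> f) w)"
    using partial_embedding_rel[OF assms(1) w] partial_embedding_rel[OF assms(2) w(1)] w(2)
    by (metis length_map map_map)
qed

lemma partial_embedding_inv_into:
  assumes f: "partial_embedding L M N D f" and "D \<subseteq> universe M"
  shows "partial_embedding L N M (f ` D) (inv_into D f)"
  unfolding partial_embedding_def
proof (intro conjI allI impI; (elim conjE)?)
  show "inj_on (inv_into D f) (f ` D)" by (simp add: inj_on_inv_into)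
  show "inv_into D f ` f ` D \<subseteq> universe M" using assms by (auto simp: partial_embedding_def)
  fix i w assume w: "i < length L" "length w = L ! i" "set w \<subseteq> f ` D"
  then have "map f (map (inv_into D f) w) = w"
    by (auto simp: map_idI f_inv_into_f subset_iff)
  moreover have "set (map (inv_into D f) w) \<subseteq> D" using w(3) by (auto intro: inv_into_into)
  ultimately show "rel N i w = rel M i (map (inv_into D f) w)"
    using partial_embedding_rel[OF f w(1)] w(2) by (metis length_map)
qed

lemma partial_embedding_if_local:
  assumes arity: "\<And>i. i < length L \<Longrightarrow> L ! i \<le> k" and "k \<ge> 2"
    and local: "\<And>B. finite B \<Longrightarrow> B \<subseteq> D \<Longrightarrow> card B \<le> k \<Longrightarrow> partial_embedding L M N B f"
  shows "partial_embedding L M N D f"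
  unfolding partial_embedding_def
proof (intro conjI allI impI; (elim conjE)?)
  have pair: "partial_embedding L M N {x, y} f" if "x \<in> D" "y \<in> D" for x y
  proof (rule local)
    have "card {x, y} \<le> 2" by (simp add: card_insert_if)
    then show "card {x, y} \<le> k" using \<open>k \<ge> 2\<close> by simp
  qed (use that in auto)
  show "inj_on f D"
    by (rule inj_onI) (use pair in \<open>auto simp: partial_embedding_def inj_on_def\<close>)
  show "f ` D \<subseteq> universe N" using pair by (auto simp: partial_embedding_def)
  fix i w assume w: "i < length L" "length w = L ! i" "set w \<subseteq> D"
  have "card (set w) \<le> k" using card_length[of w] w(2) arity[OF w(1)] by simp
  then have "partial_embedding L M N (set w) f" using w(3) by (intro local) auto
  then show "rel M i w = rel N i (map f w)" using partial_embedding_rel w by fastforce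
qed

lemma partial_embedding_Diff:
  assumes "partial_embedding L N M D \<theta>" "T \<subseteq> D"
  shows "\<theta> ` (D - T) \<subseteq> universe M - \<theta> ` T"
  using assms inj_on_image_set_diff[of \<theta> D D T] by (auto simp: partial_embedding_def)

lemma isomorphic_iff_partial_embedding:
  "isomorphic L M N \<longleftrightarrow>
    (\<exists>f. partial_embedding L M N (universe M) f \<and> f ` universe M = universe N)"
  by (auto simp: isomorphic_def partial_embedding_def bij_betw_def)

lemma isomorphic_if_partial_embedding:
  assumes "finite (universe M)" "has_order N (card (universe M))"
    and f: "partial_embedding L N M (universe N) f"
  shows "isomorphic L M N"
proof -
  have image: "f ` universe N = universe M"
    using assms
    by (intro card_subset_eq) (auto simp: partial_embedding_def has_order_def card_image)
  then have "partial_embedding L M N (universe M) (inv_into (universe N) f)"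
    using partial_embedding_inv_into[OF f order_refl] by simp
  moreover have "inj_on f (universe N)" using f by (simp add: partial_embedding_def)
  then have "inv_into (universe N) f ` universe M = universe N"
    unfolding image[symmetric] by (simp add: inv_into_image_cancel)
  ultimately show ?thesis unfolding isomorphic_iff_partial_embedding by blast
qed

subsection \<open>The semantics of Bernays--Schoenfinkel formulas\<close>

definition variants :: "'a struct \<Rightarrow> (nat \<Rightarrow> 'a) \<Rightarrow> nat list \<Rightarrow> (nat \<Rightarrow> 'a) set" where
  "variants M e vs = {e'. (\<forall>v. v \<notin> set vs \<longrightarrow> e' v = e v) \<and> e' ` set vs \<subseteq> universe M}"

lemma override_on_in_variants:
  "a ` set vs \<subseteq> universe M \<Longrightarrow> override_on e a (set vs) \<in> variants M e vs"
  by (auto simp: variants_def)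

lemma variants_Nil [simp]: "variants M e [] = {e}"
  by (auto simp: variants_def)

lemma variants_Cons: "variants M e (v # vs) = (\<Union>a \<in> universe M. variants M (e(v := a)) vs)"
proof (intro equalityI subsetI)
  fix e' assume "e' \<in> variants M e (v # vs)"
  then show "e' \<in> (\<Union>a \<in> universe M. variants M (e(v := a)) vs)"
    by (intro UN_I[of "e' v"]) (auto simp: variants_def)
next
  fix e' assume "e' \<in> (\<Union>a \<in> universe M. variants M (e(v := a)) vs)"
  then show "e' \<in> variants M e (v # vs)"
    by (cases "v \<in> set vs") (auto simp: variants_def)
qed

lemma sat_foldr_Ex: "sat M e (foldr Ex vs \<phi>) \<longleftrightarrow> (\<exists>e' \<in> variants M e vs. sat M e' \<phi>)"
  by (induction vs arbitrary: e) (auto simp: variants_Cons)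

lemma sat_foldr_All: "sat M e (foldr All vs \<phi>) \<longleftrightarrow> (\<forall>e' \<in> variants M e vs. sat M e' \<phi>)"
  by (induction vs arbitrary: e) (auto simp: variants_Cons)

lemma fm_over_foldr [simp]:
  "fm_over L (foldr Ex vs \<phi>) = fm_over L \<phi>" "fm_over L (foldr All vs \<phi>) = fm_over L \<phi>"
  by (induction vs) auto

lemma free_vars_foldr [simp]:
  "free_vars (foldr Ex vs \<phi>) = free_vars \<phi> - set vs"
  "free_vars (foldr All vs \<phi>) = free_vars \<phi> - set vs"
  by (induction vs) auto

lemma sat_partial_embedding:
  assumes \<theta>: "partial_embedding L N M (e ` W) \<theta>" and e': "\<And>v. v \<in> W \<Longrightarrow> e' v = \<theta> (e v)"
    and "quantifier_free \<psi>" "fm_over L \<psi>" "free_vars \<psi> \<subseteq> W"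
  shows "sat N e \<psi> \<longleftrightarrow> sat M e' \<psi>"
  using assms(3-)
proof (induction \<psi>)
  case (Eq x y)
  then show ?case using \<theta> e' by (auto simp: partial_embedding_def inj_on_def)
next
  case (Rel i xs)
  have "map e' xs = map \<theta> (map e xs)" using Rel.prems(3) e' by auto
  moreover have "rel M i (map \<theta> (map e xs)) = rel N i (map e xs)"
    by (rule partial_embedding_rel[OF \<theta>]) (use Rel.prems in auto)
  ultimately show ?case by (simp only: sat.simps)
qed auto

definition atoms :: "nat list \<Rightarrow> nat set \<Rightarrow> fm set" where
  "atoms L W = (\<lambda>(x, y). Eq x y) ` (W \<times> W) \<union>
    (\<Union>i<length L. Rel i ` {xs. set xs \<subseteq> W \<and> length xs = L ! i})"

lemma finite_atoms: "finite W \<Longrightarrow> finite (atoms L W)"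
  by (auto simp: atoms_def intro: finite_lists_length_eq)

lemma quantifier_free_atoms:
  "\<alpha> \<in> atoms L W \<Longrightarrow> quantifier_free \<alpha> \<and> fm_over L \<alpha> \<and> free_vars \<alpha> \<subseteq> W"
  by (auto simp: atoms_def)

lemma partial_embedding_if_atoms_agree:
  assumes atoms: "\<And>\<alpha>. \<alpha> \<in> atoms L W \<Longrightarrow> sat N e \<alpha> \<longleftrightarrow> sat M e' \<alpha>" and "e' ` W \<subseteq> universe M"
  obtains \<theta> where "partial_embedding L N M (e ` W) \<theta>" "\<And>v. v \<in> W \<Longrightarrow> \<theta> (e v) = e' v"
proof
  define \<theta> where "\<theta> = e' \<circ> inv_into W e"
  have eq: "e x = e y \<longleftrightarrow> e' x = e' y" if "x \<in> W" "y \<in> W" for x y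
    using atoms[of "Eq x y"] that by (auto simp: atoms_def)
  show \<theta>: "\<theta> (e v) = e' v" if "v \<in> W" for v
    using that eq[OF inv_into_into[of "e v" e W] that] by (simp add: \<theta>_def f_inv_into_f)
  show "partial_embedding L N M (e ` W) \<theta>"
    unfolding partial_embedding_def
  proof (intro conjI allI impI; (elim conjE)?)
    show "inj_on \<theta> (e ` W)" using \<theta> eq by (auto simp: inj_on_def)
    show "\<theta> ` e ` W \<subseteq> universe M" using \<theta> assms(2) by auto
    fix i w assume w: "i < length L" "length w = L ! i" "set w \<subseteq> e ` W"
    then have "w \<in> map e ` lists W" unfolding lists_image[symmetric] by (simp add: lists_eq_set)
    then obtain xs where xs: "w = map e xs" "set xs \<subseteq> W" by (auto simp: lists_eq_set)
    then have "map \<theta> w = map e' xs" using \<theta> by auto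
    moreover have "Rel i xs \<in> atoms L W" using w xs by (auto simp: atoms_def)
    ultimately show "rel N i w = rel M i (map \<theta> w)"
      using atoms[of "Rel i xs"] xs(1) by (simp only: sat.simps)
  qed
qed

lemma ex_fm_sat_iff_truth_set:
  assumes "finite F" "\<And>\<alpha>. \<alpha> \<in> F \<Longrightarrow> quantifier_free \<alpha> \<and> fm_over L \<alpha> \<and> free_vars \<alpha> \<subseteq> W"
  shows "\<exists>\<psi>. quantifier_free \<psi> \<and> fm_over L \<psi> \<and> free_vars \<psi> \<subseteq> W \<and>
    (\<forall>(N :: 'a struct) e. sat N e \<psi> \<longleftrightarrow> P {\<alpha> \<in> F. sat N e \<alpha>})"
  using assms
proof (induction F arbitrary: P rule: finite_induct)
  case empty
  show ?case by (rule exI[of _ "if P {} then Neg Bot else Bot"]) simp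
next
  case (insert \<alpha> F)
  obtain \<chi> where \<chi>: "quantifier_free \<chi>" "fm_over L \<chi>" "free_vars \<chi> \<subseteq> W"
    "\<And>(N :: 'a struct) e. sat N e \<chi> \<longleftrightarrow> P (insert \<alpha> {\<beta> \<in> F. sat N e \<beta>})"
    using insert.IH[of "\<lambda>T. P (insert \<alpha> T)"] insert.prems by auto
  obtain \<xi> where \<xi>: "quantifier_free \<xi>" "fm_over L \<xi>" "free_vars \<xi> \<subseteq> W"
    "\<And>(N :: 'a struct) e. sat N e \<xi> \<longleftrightarrow> P {\<beta> \<in> F. sat N e \<beta>}"
    using insert.IH[of P] insert.prems by auto
  have split: "{\<beta> \<in> insert \<alpha> F. sat N e \<beta>} =
      (if sat N e \<alpha> then insert \<alpha> {\<beta> \<in> F. sat N e \<beta>} else {\<beta> \<in> F. sat N e \<beta>})"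
    for N :: "'a struct" and e by auto
  have "sat N e (Or (And \<alpha> \<chi>) (And (Neg \<alpha>) \<xi>)) \<longleftrightarrow> P {\<beta> \<in> insert \<alpha> F. sat N e \<beta>}"
    for N :: "'a struct" and e unfolding split by (simp add: \<chi> \<xi>)
  moreover have "quantifier_free \<alpha> \<and> fm_over L \<alpha> \<and> free_vars \<alpha> \<subseteq> W"
    using insert.prems by simp
  ultimately show ?case
    using \<chi>(1-3) \<xi>(1-3) by (intro exI[of _ "Or (And \<alpha> \<chi>) (And (Neg \<alpha>) \<xi>)"]) simp
qed

lemma ex_fm_realizing_atomic_types:
  fixes M :: "'a struct"
  assumes "finite W"
  obtains \<psi> where "quantifier_free \<psi>" "fm_over L \<psi>" "free_vars \<psi> \<subseteq> W"
    "\<And>(N :: 'a struct) e. sat N e \<psi> \<longleftrightarrow>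
      (\<exists>e'. Q e' \<and> (\<forall>\<alpha> \<in> atoms L W. sat N e \<alpha> \<longleftrightarrow> sat M e' \<alpha>))"
proof -
  define P where "P T \<longleftrightarrow> (\<exists>e'. Q e' \<and> T = {\<alpha> \<in> atoms L W. sat M e' \<alpha>})" for T
  obtain \<psi> where \<psi>: "quantifier_free \<psi>" "fm_over L \<psi>" "free_vars \<psi> \<subseteq> W"
    "\<And>(N :: 'a struct) e. sat N e \<psi> \<longleftrightarrow> P {\<alpha> \<in> atoms L W. sat N e \<alpha>}"
    using ex_fm_sat_iff_truth_set[OF finite_atoms[OF assms, of L] quantifier_free_atoms,
        where P = P]
    by blast
  have "{\<alpha> \<in> atoms L W. sat N e \<alpha>} = {\<alpha> \<in> atoms L W. sat M e' \<alpha>} \<longleftrightarrow>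
      (\<forall>\<alpha> \<in> atoms L W. sat N e \<alpha> \<longleftrightarrow> sat M e' \<alpha>)" for N :: "'a struct" and e e'
    by blast
  then show ?thesis by (intro that[OF \<psi>(1-3)]) (simp add: \<psi>(4) P_def)
qed

text \<open>This is exactly what a Bernays--Schoenfinkel formula with \<open>r\<close> universal quantifiers can say
  about \<open>N\<close> relative to \<open>M\<close> when \<open>T\<close> are the existential witnesses in \<open>N\<close> and \<open>\<tau> ` T\<close> are those
  in \<open>M\<close>.\<close>

definition locally_embeds ::
  "nat list \<Rightarrow> nat \<Rightarrow> 'b set \<Rightarrow> ('b \<Rightarrow> 'a) \<Rightarrow> 'b struct \<Rightarrow> 'a struct \<Rightarrow> bool" where
  "locally_embeds L r T \<tau> N M \<longleftrightarrow>
    (\<forall>B. finite B \<and> B \<subseteq> universe N \<and> card B \<le> r \<longrightarrow>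
      (\<exists>\<theta>. partial_embedding L N M (T \<union> B) \<theta> \<and> (\<forall>x \<in> T. \<theta> x = \<tau> x)))"

lemma locally_embedsE:
  assumes "locally_embeds L r T \<tau> N M" "finite B" "B \<subseteq> universe N" "card B \<le> r"
  obtains \<theta> where "partial_embedding L N M (T \<union> B) \<theta>" "\<And>x. x \<in> T \<Longrightarrow> \<theta> x = \<tau> x"
proof -
  have "\<exists>\<theta>. partial_embedding L N M (T \<union> B) \<theta> \<and> (\<forall>x \<in> T. \<theta> x = \<tau> x)"
    using assms by (simp add: locally_embeds_def)
  then show ?thesis using that by blast
qed

lemma partial_embedding_if_locally_embeds:
  assumes "locally_embeds L r T \<tau> N M"
  shows "partial_embedding L N M T \<tau>"
proof (rule locally_embedsE[OF assms, of "{}"])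
  fix \<theta> assume "partial_embedding L N M (T \<union> {}) \<theta>" "\<And>x. x \<in> T \<Longrightarrow> \<theta> x = \<tau> x"
  then show ?thesis using partial_embedding_cong[of T \<theta> \<tau>] by simp
qed simp_all

lemma locally_embeds_if_variants_match:
  assumes "universe N \<noteq> {}" "set xs \<inter> Y = {}" "\<sigma> ` Y \<subseteq> universe M"
    and match: "\<And>e'. e' \<in> variants N e xs \<Longrightarrow>
      \<exists>e''. (\<forall>v \<in> Y. e'' v = \<sigma> v) \<and> e'' ` set xs \<subseteq> universe M \<and>
        (\<forall>\<alpha> \<in> atoms L (Y \<union> set xs). sat N e' \<alpha> \<longleftrightarrow> sat M e'' \<alpha>)"
  shows "\<exists>\<tau>. \<tau> ` e ` Y = \<sigma> ` Y \<and> locally_embeds L (card (set xs)) (e ` Y) \<tau> N M"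
proof -
  have extend: "\<exists>\<theta>. partial_embedding L N M (e ` Y \<union> B) \<theta> \<and> (\<forall>v \<in> Y. \<theta> (e v) = \<sigma> v)"
    if B: "finite B" "B \<subseteq> universe N" "card B \<le> card (set xs)" for B
  proof -
    obtain b where b: "B \<subseteq> b ` set xs" "b ` set xs \<subseteq> universe N"
      using ex_image_between[OF B(1) _ B(3,2) \<open>universe N \<noteq> {}\<close>] by blast
    define e' where "e' = override_on e b (set xs)"
    have e'_Y: "e' v = e v" if "v \<in> Y" for v
      using assms(2) that by (auto simp: e'_def override_on_def)
    then have image: "e' ` (Y \<union> set xs) = e ` Y \<union> b ` set xs" by (auto simp: e'_def image_Un)
    obtain e'' where e'': "\<forall>v \<in> Y. e'' v = \<sigma> v" "e'' ` set xs \<subseteq> universe M"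
      "\<forall>\<alpha> \<in> atoms L (Y \<union> set xs). sat N e' \<alpha> \<longleftrightarrow> sat M e'' \<alpha>"
      using match[of e'] override_on_in_variants[OF b(2)] by (auto simp: e'_def)
    moreover have "e'' ` (Y \<union> set xs) \<subseteq> universe M" using e''(1,2) assms(3) by auto
    ultimately obtain \<theta> where \<theta>: "partial_embedding L N M (e ` Y \<union> b ` set xs) \<theta>"
      "\<And>v. v \<in> Y \<union> set xs \<Longrightarrow> \<theta> (e' v) = e'' v"
      using partial_embedding_if_atoms_agree image by metis
    have "partial_embedding L N M (e ` Y \<union> B) \<theta>"
      using b(1) by (intro partial_embedding_subset[OF \<theta>(1)]) auto
    moreover have "\<forall>v \<in> Y. \<theta> (e v) = \<sigma> v" using \<theta>(2) e''(1) e'_Y by (metis UnI1)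
    ultimately show ?thesis by blast
  qed
  from extend[of "{}"] obtain \<tau> where \<tau>: "\<forall>v \<in> Y. \<tau> (e v) = \<sigma> v" by auto
  have "locally_embeds L (card (set xs)) (e ` Y) \<tau> N M"
    unfolding locally_embeds_def using extend \<tau> by fastforce
  moreover have "\<tau> ` e ` Y = \<sigma> ` Y" using \<tau> by (simp add: image_image)
  ultimately show ?thesis by blast
qed

lemma ex_bs_formula_forcing_locally_embeds:
  fixes M :: "'a struct"
  assumes "finite S" "S \<subseteq> universe M"
  obtains \<phi> where "bs_formula L (card S) r \<phi>" "true_on M \<phi>"
    "\<And>N :: 'a struct. universe N \<noteq> {} \<Longrightarrow> true_on N \<phi> \<Longrightarrow>
      \<exists>T \<tau>. T \<subseteq> universe N \<and> \<tau> ` T = S \<and> locally_embeds L r T \<tau> N M"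
proof -
  define ys xs where "ys = [0..<card S]" and "xs = [card S..<card S + r]"
  let ?W = "set ys \<union> set xs"
  have lists: "length ys = card S" "length xs = r" "distinct (ys @ xs)"
    and disjoint: "set xs \<inter> set ys = {}" and card_xs: "card (set xs) = r"
    by (auto simp: ys_def xs_def)
  obtain \<sigma> where "bij_betw \<sigma> {0..<card S} S" using ex_bij_betw_nat_finite[OF assms(1)] ..
  then have \<sigma>: "\<sigma> ` set ys = S" by (simp add: ys_def bij_betw_def)
  define Q where "Q e \<longleftrightarrow> (\<forall>v \<in> set ys. e v = \<sigma> v) \<and> e ` set xs \<subseteq> universe M" for e
  obtain \<psi> where \<psi>: "quantifier_free \<psi>" "fm_over L \<psi>" "free_vars \<psi> \<subseteq> ?W"
    "\<And>(N :: 'a struct) e. sat N e \<psi> \<longleftrightarrow>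
      (\<exists>e'. Q e' \<and> (\<forall>\<alpha> \<in> atoms L ?W. sat N e \<alpha> \<longleftrightarrow> sat M e' \<alpha>))"
    using ex_fm_realizing_atomic_types[of ?W L Q M] by blast
  define \<phi> where "\<phi> = foldr Ex ys (foldr All xs \<psi>)"
  have "fm_over L \<phi>" "free_vars \<phi> = {}" using \<psi>(2,3) by (auto simp: \<phi>_def)
  then have "bs_formula L (card S) r \<phi>" unfolding bs_formula_def using lists \<psi>(1) \<phi>_def by blast
  moreover have "true_on M \<phi>"
    unfolding true_on_def \<phi>_def sat_foldr_Ex sat_foldr_All
  proof (intro allI bexI ballI)
    fix e e' assume "e' \<in> variants M (override_on e \<sigma> (set ys)) xs"
    then have "Q e'" using disjoint by (auto simp: Q_def variants_def)
    then show "sat M e' \<psi>" using \<psi>(4) by blast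
  next
    show "override_on e \<sigma> (set ys) \<in> variants M e ys" for e
      using \<sigma> assms(2) by (intro override_on_in_variants) simp
  qed
  moreover have "\<exists>T \<tau>. T \<subseteq> universe N \<and> \<tau> ` T = S \<and> locally_embeds L r T \<tau> N M"
    if N: "universe N \<noteq> {}" "true_on N \<phi>" for N :: "'a struct"
  proof -
    have "sat N undefined \<phi>" using N(2) by (simp add: true_on_def)
    then obtain e where e: "e \<in> variants N undefined ys" "\<forall>e' \<in> variants N e xs. sat N e' \<psi>"
      unfolding \<phi>_def sat_foldr_Ex sat_foldr_All by blast
    have "\<exists>\<tau>. \<tau> ` e ` set ys = \<sigma> ` set ys \<and> locally_embeds L (card (set xs)) (e ` set ys) \<tau> N M"
      by (rule locally_embeds_if_variants_match[OF N(1) disjoint])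
        (use e(2) \<sigma> assms(2) in \<open>auto simp: \<psi>(4) Q_def\<close>)
    moreover have "e ` set ys \<subseteq> universe N" using e(1) by (simp add: variants_def)
    ultimately show ?thesis unfolding \<sigma> card_xs by blast
  qed
  ultimately show ?thesis by (rule that)
qed

lemma sat_matrix_if_locally_embeds:
  assumes emb: "locally_embeds L r T \<tau> N M" and "length xs \<le> r"
    and \<psi>: "quantifier_free \<psi>" "fm_over L \<psi>" "free_vars \<psi> \<subseteq> set ys \<union> set xs"
    and witnesses: "\<And>v. v \<in> set ys \<Longrightarrow> e' v \<in> T" "\<And>v. v \<in> set ys \<Longrightarrow> \<tau> (e' v) = e v"
    and in_N: "e' ` set xs \<subseteq> universe N" and sat_M: "\<forall>e'' \<in> variants M e xs. sat M e'' \<psi>"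
  shows "sat N e' \<psi>"
proof -
  have "card (e' ` set xs) \<le> r"
    using card_image_le[of "set xs" e'] card_length[of xs] assms(2) by simp
  then obtain \<theta> where \<theta>: "partial_embedding L N M (T \<union> e' ` set xs) \<theta>"
    "\<And>x. x \<in> T \<Longrightarrow> \<theta> x = \<tau> x"
    using locally_embedsE[OF emb, of "e' ` set xs"] in_N by auto
  define e'' where "e'' = override_on e (\<theta> \<circ> e') (set xs)"
  have "sat N e' \<psi> \<longleftrightarrow> sat M e'' \<psi>"
  proof (rule sat_partial_embedding[OF _ _ \<psi>])
    show "partial_embedding L N M (e' ` (set ys \<union> set xs)) \<theta>"
      by (rule partial_embedding_subset[OF \<theta>(1)]) (use witnesses(1) in auto)
    show "e'' v = \<theta> (e' v)" if "v \<in> set ys \<union> set xs" for v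
      using that \<theta>(2) witnesses by (auto simp: e''_def override_on_def)
  qed
  moreover have "e'' \<in> variants M e xs"
    unfolding e''_def using \<theta>(1)
    by (intro override_on_in_variants) (auto simp: partial_embedding_def)
  ultimately show ?thesis using sat_M by blast
qed

lemma ex_witnesses_bs_formula:
  fixes M :: "'a struct"
  assumes "bs_formula L p r \<phi>" "true_on M \<phi>"
  obtains S where "S \<subseteq> universe M" "card S \<le> p"
    "\<And>(N :: 'a struct) T \<tau>. T \<subseteq> universe N \<Longrightarrow> \<tau> ` T = S \<Longrightarrow> locally_embeds L r T \<tau> N M \<Longrightarrow>
      true_on N \<phi>"
proof -
  obtain ys xs \<psi> where bs: "length ys = p" "length xs = r" "distinct (ys @ xs)"
    "quantifier_free \<psi>" "\<phi> = foldr Ex ys (foldr All xs \<psi>)" "fm_over L \<phi>" "free_vars \<phi> = {}"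
    using assms(1) unfolding bs_formula_def by blast
  have \<psi>: "fm_over L \<psi>" "free_vars \<psi> \<subseteq> set ys \<union> set xs" using bs by auto
  have "sat M undefined \<phi>" using assms(2) by (simp add: true_on_def)
  then obtain e where e: "e \<in> variants M undefined ys" "\<forall>e' \<in> variants M e xs. sat M e' \<psi>"
    unfolding bs(5) sat_foldr_Ex sat_foldr_All by blast
  show ?thesis
  proof (rule that[of "e ` set ys"])
    show "e ` set ys \<subseteq> universe M" using e(1) by (simp add: variants_def)
    show "card (e ` set ys) \<le> p"
      using card_image_le[of "set ys" e] card_length[of ys] bs(1) by simp
    fix N :: "'a struct" and T \<tau>
    assume T: "T \<subseteq> universe N" "\<tau> ` T = e ` set ys" and emb: "locally_embeds L r T \<tau> N M"
    define d where "d = inv_into T \<tau> \<circ> e"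
    have d: "d v \<in> T" "\<tau> (d v) = e v" if "v \<in> set ys" for v
      using T(2) that unfolding d_def by (auto intro: inv_into_into f_inv_into_f)
    show "true_on N \<phi>"
      unfolding true_on_def bs(5) sat_foldr_Ex sat_foldr_All
    proof (intro allI bexI ballI)
      show "override_on e0 d (set ys) \<in> variants N e0 ys" for e0
        using d(1) T(1) by (intro override_on_in_variants) auto
      fix e0 e' assume e': "e' \<in> variants N (override_on e0 d (set ys)) xs"
      then have "e' v = d v" if "v \<in> set ys" for v
        using that bs(3) by (auto simp: variants_def)
      then show "sat N e' \<psi>"
        using e' d
        by (intro sat_matrix_if_locally_embeds[OF emb _ bs(4) \<psi> _ _ _ e(2)])
          (auto simp: variants_def bs(2))
    qed
  qed
qed

definition determines :: "nat list \<Rightarrow> nat \<Rightarrow> 'a struct \<Rightarrow> 'a set \<Rightarrow> bool" where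
  "determines L r M S \<longleftrightarrow> S \<subseteq> universe M \<and>
    (\<forall>(N :: 'a struct) T \<tau>. has_order N (card (universe M)) \<and> T \<subseteq> universe N \<and> \<tau> ` T = S \<and>
      locally_embeds L r T \<tau> N M \<longrightarrow> isomorphic L M N)"

lemma determines_universe:
  assumes "finite (universe M)"
  shows "determines L r M (universe M)"
  unfolding determines_def
proof (intro conjI allI impI order_refl, elim conjE)
  fix N :: "'a struct" and T \<tau>
  assume N: "has_order N (card (universe M))" and T: "T \<subseteq> universe N" "\<tau> ` T = universe M"
    and emb: "locally_embeds L r T \<tau> N M"
  have "T = universe N"
  proof (rule card_seteq[OF _ T(1)])
    show "finite (universe N)" using N by (simp add: has_order_def)
    then show "card (universe N) \<le> card T"
      using N T card_image_le[of T \<tau>] by (auto simp: has_order_def dest: finite_subset)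
  qed
  then show "isomorphic L M N"
    using isomorphic_if_partial_embedding[OF assms N] partial_embedding_if_locally_embeds[OF emb]
    by blast
qed

lemma ex_identifying_bs_formula:
  fixes M :: "nat struct"
  assumes "finite (universe M)" "universe M \<noteq> {}" "determines L r M S"
  shows "\<exists>\<phi>. bs_formula L (card S) r \<phi> \<and> identifies L \<phi> M"
proof -
  have S: "S \<subseteq> universe M" using assms(3) by (simp add: determines_def)
  then have "finite S" using assms(1) by (rule finite_subset)
  then obtain \<phi> where \<phi>: "bs_formula L (card S) r \<phi>" "true_on M \<phi>"
    "\<And>N :: nat struct. universe N \<noteq> {} \<Longrightarrow> true_on N \<phi> \<Longrightarrow>
      \<exists>T \<tau>. T \<subseteq> universe N \<and> \<tau> ` T = S \<and> locally_embeds L r T \<tau> N M"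
    using ex_bs_formula_forcing_locally_embeds S by metis
  have "\<not> true_on N \<phi>" if N: "has_order N (card (universe M))" "\<not> isomorphic L M N"
    for N :: "nat struct"
  proof -
    have "universe N \<noteq> {}" using N(1) assms(1,2) by (auto simp: has_order_def)
    then show ?thesis using N assms(3) \<phi>(3)[of N] unfolding determines_def by metis
  qed
  then show ?thesis using \<phi>(1,2) by (auto simp: identifies_def)
qed

lemma ex_determines_if_identifies:
  fixes M :: "nat struct"
  assumes "bs_formula L p r \<phi>" "identifies L \<phi> M"
  shows "\<exists>S. card S \<le> p \<and> determines L r M S"
proof -
  have "true_on M \<phi>" using assms(2) by (simp add: identifies_def)
  then obtain S where "S \<subseteq> universe M" "card S \<le> p"
    "\<And>(N :: nat struct) T \<tau>. T \<subseteq> universe N \<Longrightarrow> \<tau> ` T = S \<Longrightarrow> locally_embeds L r T \<tau> N M \<Longrightarrow>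
      true_on N \<phi>"
    using ex_witnesses_bs_formula[OF assms(1)] by metis
  then show ?thesis using assms(2) unfolding identifies_def determines_def by blast
qed

lemma BS_le_iff_determines:
  fixes M :: "nat struct"
  assumes "finite (universe M)" "universe M \<noteq> {}"
  shows "BS q L M \<le> m \<longleftrightarrow> (\<exists>r S. r \<le> q \<and> card S + r \<le> m \<and> determines L r M S)"
proof
  let ?P = "\<lambda>m. \<exists>p r \<phi>. m = p + r \<and> r \<le> q \<and> bs_formula L p r \<phi> \<and> identifies L \<phi> M"
  assume "BS q L M \<le> m"
  moreover have "?P (card (universe M) + 0)"
    using ex_identifying_bs_formula[OF assms determines_universe[OF assms(1)]] by blast
  then have "?P (BS q L M)" unfolding BS_def by (rule LeastI)
  ultimately show "\<exists>r S. r \<le> q \<and> card S + r \<le> m \<and> determines L r M S"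
    using ex_determines_if_identifies by (metis add_le_mono1 order_trans)
next
  assume "\<exists>r S. r \<le> q \<and> card S + r \<le> m \<and> determines L r M S"
  then obtain r S where S: "r \<le> q" "card S + r \<le> m" "determines L r M S" by blast
  then have "BS q L M \<le> card S + r"
    unfolding BS_def using ex_identifying_bs_formula[OF assms] by (intro Least_le) blast
  then show "BS q L M \<le> m" using S(2) by simp
qed

lemma BS_le_order:
  fixes M :: "nat struct"
  assumes "has_order M n" "n \<ge> 1"
  shows "BS q L M \<le> n"
proof -
  have M: "finite (universe M)" "universe M \<noteq> {}" "card (universe M) = n"
    using assms by (auto simp: has_order_def)
  then show ?thesis
    unfolding BS_le_iff_determines[OF M(1,2)] using determines_universe[OF M(1), of L 0]
    by (intro exI[of _ 0] exI[of _ "universe M"]) simp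
qed

subsection \<open>Types over a set\<close>

text \<open>The type of \<open>a\<close> over \<open>X\<close> is the set of relation instances that hold once every
  placeholder \<open>None\<close> is filled by \<open>a\<close>.\<close>

definition type_over :: "nat list \<Rightarrow> 'a struct \<Rightarrow> 'a set \<Rightarrow> 'a \<Rightarrow> (nat \<times> 'a option list) set"
  where "type_over L M X a =
    {(i, w). i < length L \<and> length w = L ! i \<and> set w \<subseteq> insert None (Some ` X) \<and>
      rel M i (map (case_option a id) w)}"

lemma type_over_restrict:
  "X \<subseteq> Y \<Longrightarrow> type_over L M X a =
    type_over L M Y a \<inter> {(i, w). set w \<subseteq> insert None (Some ` X)}"
  by (auto simp: type_over_def)

lemma type_over_antimono:
  "X \<subseteq> Y \<Longrightarrow> type_over L M Y a = type_over L M Y b \<Longrightarrow> type_over L M X a = type_over L M X b"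
  using type_over_restrict[of X Y L M a] type_over_restrict[of X Y L M b] by simp

lemma rel_replace:
  assumes "type_over L M X a = type_over L M X b" "i < length L" "length w = L ! i"
    "set w \<subseteq> insert a X"
  shows "rel M i (map (\<lambda>z. if z = a then b else z) w) = rel M i w"
proof -
  define w' where "w' = map (\<lambda>z. if z = a then None else Some z) w"
  have "map (case_option a id) w' = w" by (auto simp: w'_def map_idI)
  moreover have "map (case_option b id) w' = map (\<lambda>z. if z = a then b else z) w"
    by (auto simp: w'_def)
  moreover have "length w' = L ! i" "set w' \<subseteq> insert None (Some ` X)"
    using assms(3,4) by (auto simp: w'_def)
  moreover have "(i, w') \<in> type_over L M X a \<longleftrightarrow> (i, w') \<in> type_over L M X b" using assms(1) by simp
  ultimately show ?thesis using assms(2) by (simp add: type_over_def)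
qed

lemma type_over_partial_embedding:
  assumes \<theta>: "partial_embedding L N M (insert x T) \<theta>" and \<tau>: "\<And>y. y \<in> T \<Longrightarrow> \<theta> y = \<tau> y"
  shows "type_over L M (\<tau> ` T) (\<theta> x) = (\<lambda>(i, w). (i, map (map_option \<tau>) w)) ` type_over L N T x"
proof -
  have rel: "rel M i (map (case_option (\<theta> x) id) (map (map_option \<tau>) w)) =
      rel N i (map (case_option x id) w)"
    if "i < length L" "length w = L ! i" "set w \<subseteq> insert None (Some ` T)" for i w
  proof -
    have "map (case_option (\<theta> x) id) (map (map_option \<tau>) w) = map \<theta> (map (case_option x id) w)"
      using that(3) \<tau> by (auto split: option.split)
    moreover have "set (map (case_option x id) w) \<subseteq> insert x T" using that(3) by auto
    ultimately show ?thesis using partial_embedding_rel[OF \<theta> that(1)] that(2) by (metis length_map)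
  qed
  show ?thesis
  proof (intro equalityI subsetI)
    fix t assume "t \<in> type_over L M (\<tau> ` T) (\<theta> x)"
    then obtain i w where w: "t = (i, w)" "i < length L" "length w = L ! i"
      "set w \<subseteq> insert None (Some ` \<tau> ` T)" "rel M i (map (case_option (\<theta> x) id) w)"
      by (auto simp: type_over_def)
    have "insert None (Some ` \<tau> ` T) = map_option \<tau> ` insert None (Some ` T)"
      by (simp add: image_image)
    then have "w \<in> map (map_option \<tau>) ` lists (insert None (Some ` T))"
      unfolding lists_image[symmetric] using w(4) by (simp add: lists_eq_set)
    then obtain w' where "w = map (map_option \<tau>) w'" "set w' \<subseteq> insert None (Some ` T)"
      by (auto simp: lists_eq_set)
    then show "t \<in> (\<lambda>(i, w). (i, map (map_option \<tau>) w)) ` type_over L N T x"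
      using w rel[of i w'] by (auto simp: type_over_def)
  next
    fix t assume "t \<in> (\<lambda>(i, w). (i, map (map_option \<tau>) w)) ` type_over L N T x"
    then obtain i w where w: "t = (i, map (map_option \<tau>) w)" "i < length L" "length w = L ! i"
      "set w \<subseteq> insert None (Some ` T)" "rel N i (map (case_option x id) w)"
      by (auto simp: type_over_def)
    moreover have "set (map (map_option \<tau>) w) \<subseteq> insert None (Some ` \<tau> ` T)" using w(4) by auto
    ultimately show "t \<in> type_over L M (\<tau> ` T) (\<theta> x)"
      using rel[of i w] by (simp add: type_over_def)
  qed
qed

locale finite_structure =
  fixes L :: "nat list" and M :: "'a struct"
  assumes finite_universe: "finite (universe M)"
begin

abbreviation "V \<equiv> universe M"
abbreviation "tp \<equiv> type_over L M"

definition ntypes :: "'a set \<Rightarrow> nat" where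
  "ntypes X = card (tp X ` (V - X))"

lemma ex_type_representatives:
  assumes "X \<subseteq> V"
  shows "\<exists>U \<subseteq> V. card U = ntypes X \<and> inj_on (tp (V - U)) U"
proof -
  obtain U where U: "U \<subseteq> V - X" "tp X ` U = tp X ` (V - X)" "inj_on (tp X) U"
    using subset_image_inj[of "tp X ` (V - X)" "tp X" "V - X"] by (metis order_refl)
  have "inj_on (tp (V - U)) U"
  proof (rule inj_onI)
    fix x y assume "x \<in> U" "y \<in> U" "tp (V - U) x = tp (V - U) y"
    moreover have "X \<subseteq> V - U" using U(1) assms by blast
    ultimately show "x = y" using U(3) type_over_antimono by (metis inj_onD)
  qed
  moreover have "card U = ntypes X" using U card_image by (metis ntypes_def)
  ultimately show ?thesis using U(1) by blast
qed

subsection \<open>Indiscernible sets in structures with few types\<close>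

definition resolves :: "'a set \<Rightarrow> 'a set \<Rightarrow> bool" where
  "resolves X A \<longleftrightarrow>
    (\<forall>a \<in> V - (X \<union> A). \<forall>b \<in> V - (X \<union> A). tp X a = tp X b \<longrightarrow> tp A a = tp A b)"

lemma resolves_subset: "A \<subseteq> X \<Longrightarrow> resolves X A"
  by (auto simp: resolves_def dest: type_over_antimono[of A X L M])

lemma resolves_mono:
  assumes "resolves X B" "X \<subseteq> Y" "A \<subseteq> B" "B \<subseteq> Y \<union> A"
  shows "resolves Y A"
  unfolding resolves_def
proof (intro ballI impI)
  fix a b assume ab: "a \<in> V - (Y \<union> A)" "b \<in> V - (Y \<union> A)" and "tp Y a = tp Y b"
  then have "tp X a = tp X b" using assms(2) type_over_antimono by metis
  moreover have "a \<in> V - (X \<union> B)" "b \<in> V - (X \<union> B)" using ab assms(2,4) by auto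
  ultimately have "tp B a = tp B b" using assms(1) unfolding resolves_def by blast
  then show "tp A a = tp A b" using assms(3) type_over_antimono by metis
qed

definition type_saturated :: "nat \<Rightarrow> 'a set \<Rightarrow> bool" where
  "type_saturated d P \<longleftrightarrow> (\<forall>A \<subseteq> V. card A \<le> d \<longrightarrow> ntypes (P \<union> A) \<le> ntypes P)"

lemma ex_type_saturated_superset:
  assumes bound: "\<And>Y. Y \<subseteq> V \<Longrightarrow> ntypes Y \<le> u" and "X \<subseteq> V"
  shows "\<exists>P. X \<subseteq> P \<and> P \<subseteq> V \<and> card P \<le> card X + d * u \<and> type_saturated d P"
proof -
  define cheap where "cheap Y \<longleftrightarrow> X \<subseteq> Y \<and> Y \<subseteq> V \<and> card Y \<le> card X + d * ntypes Y" for Y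
  have "cheap X" using assms(2) by (simp add: cheap_def)
  moreover have "\<forall>Y. cheap Y \<longrightarrow> ntypes Y < Suc u"
    using bound by (auto simp: cheap_def le_imp_less_Suc)
  ultimately obtain P where P: "cheap P" "\<And>Y. cheap Y \<Longrightarrow> ntypes Y \<le> ntypes P"
    using ex_has_greatest_nat by metis
  have "ntypes (P \<union> A) \<le> ntypes P" if A: "A \<subseteq> V" "card A \<le> d" for A
  proof (rule ccontr)
    assume more: "\<not> ntypes (P \<union> A) \<le> ntypes P"
    have "card (P \<union> A) \<le> card X + d * (ntypes P + 1)"
      using P(1) A(2) card_Un_le[of P A] by (simp add: cheap_def)
    also have "\<dots> \<le> card X + d * ntypes (P \<union> A)"
      using more by (intro add_left_mono mult_le_mono2) simp
    finally have "cheap (P \<union> A)" using P(1) A(1) by (auto simp: cheap_def)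
    then show False using P(2) more by blast
  qed
  then have "type_saturated d P" by (simp add: type_saturated_def)
  moreover have "d * ntypes P \<le> d * u" using bound P(1) by (simp add: cheap_def)
  then have "card P \<le> card X + d * u" using P(1) unfolding cheap_def by linarith
  ultimately show ?thesis using P(1) by (auto simp: cheap_def)
qed

definition rare :: "nat \<Rightarrow> 'a set \<Rightarrow> 'a set" where
  "rare d P = {c \<in> V - P. card {b \<in> V - P. tp P b = tp P c} \<le> d}"

lemma card_rare_le: "card (rare d P) \<le> d * ntypes P"
proof (cases "rare d P = {}")
  case False
  have fin: "finite (rare d P)" using finite_universe by (simp add: rare_def)
  obtain c where c: "c \<in> rare d P"
    "card (rare d P) \<le> card (tp P -` {tp P c} \<inter> rare d P) * card (tp P ` rare d P)"
    using pigeonhole_card[of "tp P" "rare d P" "tp P ` rare d P"] fin False by auto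
  have "card (tp P -` {tp P c} \<inter> rare d P) \<le> card {b \<in> V - P. tp P b = tp P c}"
    using finite_universe by (intro card_mono) (auto simp: rare_def)
  also have "\<dots> \<le> d" using c(1) by (simp add: rare_def)
  finally have "card (tp P -` {tp P c} \<inter> rare d P) \<le> d" .
  moreover have "card (tp P ` rare d P) \<le> ntypes P"
    unfolding ntypes_def using finite_universe by (intro card_mono image_mono) (auto simp: rare_def)
  ultimately show ?thesis using c(2) mult_le_mono le_trans by blast
qed simp

text \<open>No \<open>A\<close> as below swallows a whole type class, so restricting types from \<open>P \<union> A\<close> to \<open>P\<close> is
  onto; as \<open>A\<close> does not increase their number, it is also injective.\<close>

lemma resolves_if_type_saturated:
  assumes saturated: "type_saturated d P" and A: "A \<subseteq> V - (P \<union> rare d P)" "card A \<le> d"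
  shows "resolves P (P \<union> A)"
proof -
  define types where "types = tp (P \<union> A) ` (V - (P \<union> A))"
  define \<rho> where "\<rho> t = t \<inter> {(i, w). set w \<subseteq> insert None (Some ` P)}"
    for t :: "(nat \<times> 'a option list) set"
  have \<rho>: "\<rho> (tp (P \<union> A) c) = tp P c" for c
    unfolding \<rho>_def by (rule type_over_restrict[symmetric]) simp
  have finite_types: "finite types" unfolding types_def using finite_universe by simp
  have finite_A: "finite A" using A(1) finite_universe by (meson finite_Diff finite_subset)
  have "tp P ` (V - P) \<subseteq> \<rho> ` types"
  proof
    fix t assume "t \<in> tp P ` (V - P)"
    then obtain c where c: "c \<in> V - P" "t = tp P c" by blast
    have "\<not> {b \<in> V - P. tp P b = tp P c} \<subseteq> A"
    proof
      assume swallowed: "{b \<in> V - P. tp P b = tp P c} \<subseteq> A"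
      then have "card {b \<in> V - P. tp P b = tp P c} \<le> d"
        using A(2) finite_A by (meson card_mono le_trans)
      then have "c \<in> rare d P" using c(1) by (simp add: rare_def)
      moreover have "c \<in> A" using swallowed c(1) by blast
      ultimately show False using A(1) by blast
    qed
    then obtain b where "b \<in> V - (P \<union> A)" "tp P b = t" using c(2) by blast
    then show "t \<in> \<rho> ` types" using \<rho>[of b] unfolding types_def by (metis image_eqI)
  qed
  then have "card (tp P ` (V - P)) \<le> card (\<rho> ` types)" using finite_types by (simp add: card_mono)
  moreover have "card types \<le> card (tp P ` (V - P))"
    using saturated A unfolding type_saturated_def ntypes_def types_def
    by (meson Diff_subset subset_trans)
  ultimately have "card (\<rho> ` types) = card types"
    using card_image_le[OF finite_types, of \<rho>] by linarith
  then have inj: "inj_on \<rho> types" using finite_types by (rule eq_card_imp_inj_on[rotated])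
  show ?thesis
    unfolding resolves_def
  proof (intro ballI impI)
    fix a b assume ab: "a \<in> V - (P \<union> (P \<union> A))" "b \<in> V - (P \<union> (P \<union> A))"
      and "tp P a = tp P b"
    then have "\<rho> (tp (P \<union> A) a) = \<rho> (tp (P \<union> A) b)" by (simp add: \<rho>)
    moreover have "tp (P \<union> A) a \<in> types" "tp (P \<union> A) b \<in> types"
      using ab by (auto simp: types_def)
    ultimately show "tp (P \<union> A) a = tp (P \<union> A) b" by (rule inj_onD[OF inj])
  qed
qed

lemma ex_resolving_extension:
  assumes bound: "\<And>Y. Y \<subseteq> V \<Longrightarrow> ntypes Y \<le> u" and "X \<subseteq> V"
  shows "\<exists>P Q. X \<subseteq> P \<and> P \<subseteq> Q \<and> Q \<subseteq> V \<and> card Q \<le> card X + 2 * d * u \<and>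
    (\<forall>A \<subseteq> V - Q. card A \<le> d \<longrightarrow> resolves P (P \<union> A))"
proof -
  obtain P where P: "X \<subseteq> P" "P \<subseteq> V" "card P \<le> card X + d * u" "type_saturated d P"
    using ex_type_saturated_superset[OF assms] by blast
  have "card (rare d P) \<le> d * u"
    using card_rare_le[of d P] bound[OF P(2)] by (meson le_trans mult_le_mono2)
  then have "card (P \<union> rare d P) \<le> card X + 2 * d * u"
    using P(3) card_Un_le[of P "rare d P"] by linarith
  moreover have "P \<union> rare d P \<subseteq> V" using P(2) by (auto simp: rare_def)
  ultimately show ?thesis
    using P(1) resolves_if_type_saturated[OF P(4)]
    by (intro exI[of _ P] exI[of _ "P \<union> rare d P"]) simp
qed

text \<open>An extension \<open>Q\<close> of \<open>X\<close> as above resolves every small \<open>A\<close> that avoids \<open>Q - X\<close>.  So a small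
  set that remains unresolved meets one more such difference per round.\<close>

lemma ex_resolving_set_of_small_intersection:
  assumes bound: "\<And>Y. Y \<subseteq> V \<Longrightarrow> ntypes Y \<le> u"
  shows "\<exists>X \<subseteq> V. card X \<le> 2 * d * u * j \<and>
    (\<forall>A \<subseteq> V. card A \<le> d \<and> card (A \<inter> X) < j \<longrightarrow> resolves X A)"
proof (induction j)
  case 0
  show ?case by (intro exI[of _ "{}"]) simp
next
  case (Suc j)
  then obtain X where X: "X \<subseteq> V" "card X \<le> 2 * d * u * j"
    "\<And>A. A \<subseteq> V \<Longrightarrow> card A \<le> d \<Longrightarrow> card (A \<inter> X) < j \<Longrightarrow> resolves X A"
    by blast
  obtain P Q where Q: "X \<subseteq> P" "P \<subseteq> Q" "Q \<subseteq> V" "card Q \<le> card X + 2 * d * u"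
    "\<And>A. A \<subseteq> V - Q \<Longrightarrow> card A \<le> d \<Longrightarrow> resolves P (P \<union> A)"
    using ex_resolving_extension[OF bound X(1), of d] by auto
  have "resolves Q A" if A: "A \<subseteq> V" "card A \<le> d" and meet: "card (A \<inter> Q) < Suc j" for A
  proof -
    have finite_A: "finite A" using A(1) finite_universe by (rule finite_subset)
    show ?thesis
    proof (cases "A \<inter> (Q - X) = {}")
      case True
      have "card (A - Q) \<le> d" using A(2) finite_A by (meson Diff_subset card_mono le_trans)
      then have "resolves P (P \<union> (A - Q))" using A(1) by (intro Q(5)) auto
      then show ?thesis by (rule resolves_mono) (use True Q(1,2) in auto)
    next
      case False
      then have "A \<inter> X \<subset> A \<inter> Q" using Q(1,2) by blast
      then have "card (A \<inter> X) < card (A \<inter> Q)" using finite_A by (intro psubset_card_mono) auto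
      then have "resolves X A" using meet by (intro X(3)[OF A]) linarith
      then show ?thesis by (rule resolves_mono) (use Q(1,2) in auto)
    qed
  qed
  moreover have "card Q \<le> 2 * d * u * Suc j" using Q(4) X(2) by simp
  ultimately show ?case using Q(3) by blast
qed

lemma ex_resolving_set:
  assumes "\<And>Y. Y \<subseteq> V \<Longrightarrow> ntypes Y \<le> u"
  shows "\<exists>X \<subseteq> V. card X \<le> 2 * d * u * d \<and> (\<forall>A \<subseteq> V. card A \<le> d \<longrightarrow> resolves X A)"
proof -
  obtain X where X: "X \<subseteq> V" "card X \<le> 2 * d * u * d"
    "\<And>A. A \<subseteq> V \<Longrightarrow> card A \<le> d \<Longrightarrow> card (A \<inter> X) < d \<Longrightarrow> resolves X A"
    using ex_resolving_set_of_small_intersection[OF assms, of d d] by blast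
  have "resolves X A" if A: "A \<subseteq> V" "card A \<le> d" for A
  proof (cases "A \<subseteq> X")
    case False
    then have "A \<inter> X \<subset> A" by blast
    moreover have "finite A" using A(1) finite_universe by (rule finite_subset)
    ultimately have "card (A \<inter> X) < card A" by (intro psubset_card_mono)
    then show ?thesis using A(2) by (intro X(3)[OF A]) linarith
  qed (rule resolves_subset)
  then show ?thesis using X(1,2) by blast
qed

definition indiscernible :: "nat \<Rightarrow> 'a set \<Rightarrow> bool" where
  "indiscernible d C \<longleftrightarrow> C \<subseteq> V \<and>
    (\<forall>A \<subseteq> V. card A \<le> d \<longrightarrow> (\<forall>a \<in> C - A. \<forall>b \<in> C - A. tp A a = tp A b))"

lemma ex_large_indiscernible:
  assumes "\<And>Y. Y \<subseteq> V \<Longrightarrow> ntypes Y \<le> u"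
  shows "\<exists>C. indiscernible d C \<and> card V \<le> 2 * d * u * d + u * card C"
proof -
  obtain X where X: "X \<subseteq> V" "card X \<le> 2 * d * u * d" "\<And>A. A \<subseteq> V \<Longrightarrow> card A \<le> d \<Longrightarrow> resolves X A"
    using ex_resolving_set[OF assms] by blast
  define same_type where "same_type c = {b \<in> V - X. tp X b = tp X c}" for c
  have indiscernible: "indiscernible d (same_type c)" for c
    using X(3) by (auto simp: indiscernible_def resolves_def same_type_def)
  have finite_V_X: "finite (V - X)" using finite_universe by simp
  obtain c where "card (V - X) \<le> u * card (same_type c)"
  proof (cases "V - X = {}")
    case True
    then have "card (V - X) = 0" by (simp only: card.empty)
    then show ?thesis by (intro that[of undefined]) simp
  next
    case False
    then obtain c where "card (V - X) \<le> card (tp X -` {tp X c} \<inter> (V - X)) * ntypes X"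
      using pigeonhole_card[of "tp X" "V - X" "tp X ` (V - X)"] finite_V_X
      by (auto simp: ntypes_def)
    moreover have "tp X -` {tp X c} \<inter> (V - X) = same_type c" by (auto simp: same_type_def)
    ultimately have "card (V - X) \<le> u * card (same_type c)"
      using assms[OF X(1)] by (metis le_trans mult.commute mult_le_mono2)
    then show ?thesis by (rule that)
  qed
  moreover have "card V = card X + card (V - X)"
    using X(1) finite_universe card_Un_disjoint[of X "V - X"]
    by (metis Diff_disjoint Diff_partition finite_V_X finite_subset)
  ultimately show ?thesis using X(2) indiscernible by (intro exI[of _ "same_type c"]) simp
qed

subsection \<open>Sets whose complement determines the structure\<close>

definition interchangeable :: "'a set \<Rightarrow> bool" where
  "interchangeable C \<longleftrightarrow> C \<subseteq> V \<and>
    (\<forall>a \<in> C. \<forall>b \<in> C. partial_embedding L M M V (transpose a b))"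

lemma partial_embedding_permutes_interchangeable:
  assumes C: "interchangeable C" and "\<pi> permutes C"
  shows "partial_embedding L M M V \<pi>"
proof -
  have "finite C" using C finite_universe by (auto simp: interchangeable_def intro: finite_subset)
  with assms(2) show ?thesis
  proof (induction rule: permutes_induct)
    case id
    then show ?case by (simp add: partial_embedding_def)
  next
    case (swap a b \<pi>)
    then have "partial_embedding L M M V (transpose a b)" using C by (simp add: interchangeable_def)
    moreover have "\<pi> ` V \<subseteq> V" using swap.IH by (simp add: partial_embedding_def)
    ultimately show ?case by (rule partial_embedding_comp[OF swap.IH])
  qed
qed

lemma partial_embedding_interchange:
  assumes C: "interchangeable C" and \<theta>: "partial_embedding L N M D \<theta>" and "inj_on f D"
    and inside: "\<And>x. x \<in> D \<Longrightarrow> \<theta> x \<in> C \<Longrightarrow> f x \<in> C"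
    and outside: "\<And>x. x \<in> D \<Longrightarrow> \<theta> x \<notin> C \<Longrightarrow> f x = \<theta> x"
  shows "partial_embedding L N M D f"
proof -
  define g where "g = f \<circ> inv_into D \<theta>"
  have g: "g (\<theta> x) = f x" if "x \<in> D" for x
    using \<theta> that by (simp add: g_def partial_embedding_def)
  have "finite C" using C finite_universe by (auto simp: interchangeable_def intro: finite_subset)
  moreover have "inj_on g (\<theta> ` D \<inter> C)"
    by (auto intro!: inj_onI simp: g inj_on_eq_iff[OF \<open>inj_on f D\<close>])
  moreover have "g ` (\<theta> ` D \<inter> C) \<subseteq> C" using g inside by auto
  ultimately obtain \<pi> where \<pi>: "\<pi> permutes C" "\<forall>y \<in> \<theta> ` D \<inter> C. \<pi> y = g y"
    using ex_permutes_extending[OF _ _ Int_lower2] by metis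
  have "\<theta> ` D \<subseteq> V" using \<theta> by (simp add: partial_embedding_def)
  then have "partial_embedding L N M D (\<pi> \<circ> \<theta>)"
    by (rule partial_embedding_comp[OF \<theta> partial_embedding_permutes_interchangeable[OF C \<pi>(1)]])
  moreover have "(\<pi> \<circ> \<theta>) x = f x" if "x \<in> D" for x
  proof (cases "\<theta> x \<in> C")
    case True
    then show ?thesis using \<pi>(2) g that by simp
  next
    case False
    then show ?thesis using permutes_not_in[OF \<pi>(1)] outside that by simp
  qed
  ultimately show ?thesis using partial_embedding_cong[of D "\<pi> \<circ> \<theta>" f] by simp
qed

end

locale bounded_arity_structure = finite_structure +
  fixes k :: nat
  assumes arity_le: "i < length L \<Longrightarrow> L ! i \<le> k"
begin

lemma card_set_le_arity:
  assumes "i < length L" "length w = L ! i"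
  shows "card (set w) \<le> k"
  using card_length[of w] assms(2) arity_le[OF assms(1)] by simp

lemma rel_transpose_fresh:
  assumes C: "indiscernible (k - 1) C" and w: "i < length L" "length w = L ! i" "set w \<subseteq> V"
    and ab: "a \<in> C" "b \<in> C" "b \<notin> set w"
  shows "rel M i (map (transpose a b) w) = rel M i w"
proof (cases "a \<in> set w")
  case True
  then have "card (set w - {a}) \<le> k - 1" using card_set_le_arity[OF w(1,2)] by simp
  moreover have "set w - {a} \<subseteq> V" "a \<in> C - (set w - {a})" "b \<in> C - (set w - {a})"
    using w(3) ab by auto
  ultimately have "tp (set w - {a}) a = tp (set w - {a}) b"
    using C unfolding indiscernible_def by blast
  then have "rel M i (map (\<lambda>z. if z = a then b else z) w) = rel M i w"
    by (rule rel_replace[OF _ w(1,2)]) auto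
  moreover have "map (\<lambda>z. if z = a then b else z) w = map (transpose a b) w"
    using ab(3) by (auto simp: transpose_def)
  ultimately show ?thesis by simp
next
  case False
  then have "map (transpose a b) w = w"
    using ab(3) by (intro map_idI) (auto simp: transpose_def)
  then show ?thesis by simp
qed

text \<open>A tuple that contains both \<open>a\<close> and \<open>b\<close> is handled by moving them along a third element of
  \<open>C\<close> that does not occur in it.\<close>

lemma rel_transpose:
  assumes C: "indiscernible (k - 1) C" "card C > k"
    and w: "i < length L" "length w = L ! i" "set w \<subseteq> V" and ab: "a \<in> C" "b \<in> C"
  shows "rel M i (map (transpose a b) w) = rel M i w"
proof -
  note fresh = rel_transpose_fresh[OF C(1) w(1)]
  consider "a = b" | "b \<notin> set w" | "a \<notin> set w" | "a \<in> set w" "b \<in> set w" "a \<noteq> b" by blast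
  then show ?thesis
  proof cases
    case 1
    then show ?thesis by simp
  next
    case 2
    then show ?thesis by (rule fresh[OF w(2,3) ab])
  next
    case 3
    then show ?thesis using fresh[OF w(2,3) ab(2,1)] by (simp add: transpose_commute)
  next
    case 4
    have "\<not> C \<subseteq> set w"
      using C(2) card_set_le_arity[OF w(1,2)] card_mono[of "set w" C] by auto
    then obtain c where c: "c \<in> C" "c \<notin> set w" by blast
    have "C \<subseteq> V" using C(1) by (simp add: indiscernible_def)
    define w1 where "w1 = map (transpose a c) w"
    have w1: "length w1 = L ! i" "set w1 \<subseteq> V" "a \<notin> set w1"
      using w c 4 \<open>C \<subseteq> V\<close> by (auto simp: w1_def transpose_def)
    define w2 where "w2 = map (transpose b a) w1"
    have w2: "length w2 = L ! i" "set w2 \<subseteq> V" "b \<notin> set w2"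
      using w1 ab 4 \<open>C \<subseteq> V\<close> by (auto simp: w2_def transpose_def)
    have "map (transpose a b) w = map (transpose c b) w2"
      using c 4 unfolding w2_def w1_def by (auto simp: transpose_def)
    also have "rel M i \<dots> = rel M i w2" by (rule fresh[OF w2(1,2) c(1) ab(2) w2(3)])
    also have "\<dots> = rel M i w1" unfolding w2_def by (rule fresh[OF w1(1,2) ab(2,1) w1(3)])
    also have "\<dots> = rel M i w" unfolding w1_def by (rule fresh[OF w(2,3) ab(1) c])
    finally show ?thesis .
  qed
qed

lemma interchangeable_if_indiscernible:
  assumes "indiscernible (k - 1) C" "card C > k"
  shows "interchangeable C"
proof -
  have "C \<subseteq> V" using assms(1) by (simp add: indiscernible_def)
  moreover have "partial_embedding L M M V (transpose a b)" if "a \<in> C" "b \<in> C" for a b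
    unfolding partial_embedding_def
  proof (intro conjI allI impI; (elim conjE)?)
    show "transpose a b ` V \<subseteq> V" using that \<open>C \<subseteq> V\<close> by (auto simp: transpose_def)
  qed (simp_all add: rel_transpose[OF assms _ _ _ that])
  ultimately show ?thesis by (simp add: interchangeable_def)
qed

lemma isomorphic_if_locally_partial_embedding:
  assumes "k \<ge> 2" "has_order N (card V)"
    and "\<And>B. finite B \<Longrightarrow> B \<subseteq> universe N \<Longrightarrow> card B \<le> k \<Longrightarrow> partial_embedding L N M B f"
  shows "isomorphic L M N"
  by (rule isomorphic_if_partial_embedding[OF finite_universe assms(2)
        partial_embedding_if_local[OF arity_le assms(1,3)]])

lemma partial_embeddings_agree_if_distinct_types:
  assumes inj: "inj_on (tp (\<tau> ` T)) (V - \<tau> ` T)"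
    and "partial_embedding L N M (insert x T) \<theta>" "\<And>y. y \<in> T \<Longrightarrow> \<theta> y = \<tau> y"
    and "partial_embedding L N M (insert x T) \<theta>'" "\<And>y. y \<in> T \<Longrightarrow> \<theta>' y = \<tau> y"
  shows "\<theta> x = \<theta>' x"
proof (cases "x \<in> T")
  case True
  then show ?thesis using assms(3,5) by simp
next
  case False
  have outside: "\<theta> x \<in> V - \<tau> ` T"
    if \<theta>: "partial_embedding L N M (insert x T) \<theta>" "\<And>y. y \<in> T \<Longrightarrow> \<theta> y = \<tau> y" for \<theta>
  proof -
    have "\<theta> ` (insert x T - T) \<subseteq> V - \<theta> ` T" by (rule partial_embedding_Diff[OF \<theta>(1)]) blast
    moreover have "\<theta> ` T = \<tau> ` T" using \<theta>(2) by (rule image_cong[OF refl])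
    ultimately show ?thesis using False by auto
  qed
  have "tp (\<tau> ` T) (\<theta> x) = tp (\<tau> ` T) (\<theta>' x)"
    using type_over_partial_embedding[OF assms(2,3)] type_over_partial_embedding[OF assms(4,5)]
    by simp
  then show ?thesis
    by (rule inj_onD[OF inj _ outside[OF assms(2,3)] outside[OF assms(4,5)]])
qed

lemma determines_if_distinct_types:
  assumes "k \<ge> 2" "S \<subseteq> V" and inj: "inj_on (tp S) (V - S)"
  shows "determines L k M S"
  unfolding determines_def
proof (intro conjI allI impI assms(2), elim conjE)
  fix N :: "'a struct" and T \<tau>
  assume N: "has_order N (card V)" and T: "\<tau> ` T = S" and emb: "locally_embeds L k T \<tau> N M"
  define extends where "extends B \<theta> \<longleftrightarrow>
    partial_embedding L N M (B \<union> T) \<theta> \<and> (\<forall>y \<in> T. \<theta> y = \<tau> y)" for B \<theta>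
  have unique: "\<theta> x = \<theta>' x" if "extends {x} \<theta>" "extends {x} \<theta>'" for x \<theta> \<theta>'
    using partial_embeddings_agree_if_distinct_types[of \<tau> T N x \<theta> \<theta>'] inj that
    by (simp add: extends_def T)
  define f where "f x = (SOME \<theta>. extends {x} \<theta>) x" for x
  show "isomorphic L M N"
  proof (rule isomorphic_if_locally_partial_embedding[OF assms(1) N])
    fix B assume B: "finite B" "B \<subseteq> universe N" "card B \<le> k"
    then obtain \<theta> where \<theta>: "extends B \<theta>"
      using locally_embedsE[OF emb B] by (metis extends_def sup_commute)
    have "\<theta> x = f x" if "x \<in> B" for x
    proof -
      have "extends {x} \<theta>"
        using \<theta> that by (auto simp: extends_def elim: partial_embedding_subset)
      from unique[OF this someI[of "extends {x}", OF this]] show ?thesis by (simp add: f_def)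
    qed
    moreover have "partial_embedding L N M B \<theta>"
      using \<theta> by (auto simp: extends_def elim: partial_embedding_subset)
    ultimately show "partial_embedding L N M B f" using partial_embedding_cong[of B \<theta> f] by simp
  qed
qed

lemma determines_if_interchangeable:
  assumes "k \<ge> 2" and C: "interchangeable C"
  shows "determines L k M (V - C)"
  unfolding determines_def
proof (intro conjI allI impI Diff_subset, elim conjE)
  fix N :: "'a struct" and T \<tau>
  assume N: "has_order N (card V)" and T: "T \<subseteq> universe N" "\<tau> ` T = V - C"
    and emb: "locally_embeds L k T \<tau> N M"
  have "inj_on \<tau> T"
    using partial_embedding_if_locally_embeds[OF emb] by (simp add: partial_embedding_def)
  then obtain f where f: "bij_betw f (universe N) V" "\<forall>x \<in> T. f x = \<tau> x"
    using ex_bij_betw_extending[of "universe N" V \<tau> T] N T finite_universe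
    by (auto simp: has_order_def)
  then have inj: "inj_on f (universe N)" by (simp add: bij_betw_def)
  have f_T: "f ` T = V - C" using f(2) T(2) by (metis image_cong)
  show "isomorphic L M N"
  proof (rule isomorphic_if_locally_partial_embedding[OF assms(1) N])
    fix B assume B: "finite B" "B \<subseteq> universe N" "card B \<le> k"
    obtain \<theta> where \<theta>: "partial_embedding L N M (T \<union> B) \<theta>" "\<And>x. x \<in> T \<Longrightarrow> \<theta> x = \<tau> x"
      using locally_embedsE[OF emb B] by blast
    have \<theta>_T: "\<theta> ` T = V - C" using \<theta>(2) T(2) by (metis image_cong)
    have "partial_embedding L N M (T \<union> B) f"
    proof (rule partial_embedding_interchange[OF C \<theta>(1)])
      show "inj_on f (T \<union> B)" using T(1) B(2) by (intro inj_on_subset[OF inj]) blast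
      fix x assume x: "x \<in> T \<union> B"
      show "f x \<in> C" if "\<theta> x \<in> C"
      proof -
        have "x \<notin> T" using that \<theta>_T by blast
        then have "f x \<notin> f ` T" using x T(1) B(2) inj_on_image_mem_iff[OF inj] by blast
        moreover have "f x \<in> V" using x T(1) B(2) bij_betwE[OF f(1)] by blast
        ultimately show ?thesis using f_T by blast
      qed
      show "f x = \<theta> x" if "\<theta> x \<notin> C"
      proof -
        have "\<theta> ` (T \<union> B - T) \<subseteq> V - (V - C)"
          using partial_embedding_Diff[OF \<theta>(1), of T] \<theta>_T by simp
        then have "x \<in> T" using that x by blast
        then show ?thesis using \<theta>(2) f(2) by simp
      qed
    qed
    then show "partial_embedding L N M B f" by (rule partial_embedding_subset) blast
  qed
qed

end

subsection \<open>The upper bound\<close>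

lemma mult_add_less_square_add_square:
  fixes s x :: real
  assumes "0 \<le> s" "1 \<le> x"
  shows "s * (2 * (x - 1) ^ 2 + (s + 1)) < (s + x ^ 2) ^ 2"
proof -
  have "s * (1 + 2 * (x - 1) ^ 2) \<le> s * (2 * x ^ 2)"
    using assms by (intro mult_left_mono) (simp_all add: power2_eq_square algebra_simps)
  moreover have "0 < (x ^ 2) ^ 2" using assms(2) by simp
  ultimately show ?thesis by (simp add: power2_eq_square algebra_simps)
qed

context bounded_arity_structure
begin

lemma ex_large_interchangeable:
  assumes k: "k \<ge> 1" and s: "sqrt (card V) = s + real k ^ 2" "s \<ge> k"
    and few_types: "\<And>X. X \<subseteq> V \<Longrightarrow> real (ntypes X) \<le> s"
  shows "\<exists>C. interchangeable C \<and> real (card C) > s"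
proof -
  define u where "u = nat \<lfloor>s\<rfloor>"
  have "ntypes X \<le> u" if "X \<subseteq> V" for X using few_types[OF that] by (simp add: u_def le_nat_floor)
  then obtain C where C: "indiscernible (k - 1) C"
    "card V \<le> 2 * (k - 1) * u * (k - 1) + u * card C"
    using ex_large_indiscernible by blast
  have "real (card C) > s + 1"
  proof (rule ccontr)
    assume small: "\<not> real (card C) > s + 1"
    have k_minus_1: "real (k - 1) = real k - 1" using k by (simp add: of_nat_diff)
    have "real (card V) \<le> real (2 * (k - 1) * u * (k - 1) + u * card C)"
      using C(2) of_nat_le_iff by blast
    also have "\<dots> = real u * (2 * (real k - 1) ^ 2 + real (card C))"
      by (simp only: of_nat_add of_nat_mult of_nat_numeral k_minus_1 power2_eq_square)
        (simp add: algebra_simps)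
    also have "\<dots> \<le> s * (2 * (real k - 1) ^ 2 + (s + 1))"
      using s(2) small by (intro mult_mono add_left_mono) (auto simp: u_def)
    also have "\<dots> < (s + real k ^ 2) ^ 2"
      using k s(2) by (intro mult_add_less_square_add_square) auto
    also have "\<dots> = card V" unfolding s(1)[symmetric] by simp
    finally show False by simp
  qed
  moreover from this have "interchangeable C"
    using s(2) by (intro interchangeable_if_indiscernible[OF C(1)]) linarith
  ultimately show ?thesis by (intro exI[of _ C]) simp
qed

lemma ex_large_set_with_determining_complement:
  assumes k: "k \<ge> 2" and large: "sqrt (card V) \<ge> real k ^ 2 + real k"
  shows "\<exists>U \<subseteq> V. real (card U) > sqrt (card V) - real k ^ 2 \<and> determines L k M (V - U)"
proof (cases "\<exists>X \<subseteq> V. real (ntypes X) > sqrt (card V) - real k ^ 2")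
  case True
  then obtain X where X: "X \<subseteq> V" "real (ntypes X) > sqrt (card V) - real k ^ 2" by blast
  obtain U where U: "U \<subseteq> V" "card U = ntypes X" "inj_on (tp (V - U)) U"
    using ex_type_representatives[OF X(1)] by blast
  have "V - (V - U) = U" using U(1) by blast
  then have "determines L k M (V - U)"
    using determines_if_distinct_types[OF k, of "V - U"] U(3) by simp
  then show ?thesis using U(1,2) X(2) by auto
next
  case False
  then have "real (ntypes X) \<le> sqrt (card V) - real k ^ 2" if "X \<subseteq> V" for X
    using that by (meson not_le)
  then obtain C where C: "interchangeable C" "real (card C) > sqrt (card V) - real k ^ 2"
    using ex_large_interchangeable[of "sqrt (card V) - real k ^ 2"] k large by auto
  then have "C \<subseteq> V" by (simp add: interchangeable_def)
  then show ?thesis using C(2) determines_if_interchangeable[OF k C(1)] by blast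
qed

end

lemma BS_less:
  fixes M :: "nat struct"
  assumes L: "has_max_arity L k" and M: "has_order M n" "n \<ge> 1" and "k \<ge> 2"
  shows "real (BS k L M) < real n - sqrt n + real k ^ 2 + real k"
proof (cases "sqrt n \<ge> real k ^ 2 + real k")
  case True
  have universe: "finite (universe M)" "universe M \<noteq> {}" "card (universe M) = n"
    using M by (auto simp: has_order_def)
  interpret bounded_arity_structure L M k
    using L universe(1) by unfold_locales (auto simp: has_max_arity_def)
  obtain U where U: "U \<subseteq> V" "real (card U) > sqrt n - real k ^ 2" "determines L k M (V - U)"
    using ex_large_set_with_determining_complement[OF \<open>k \<ge> 2\<close>] True universe(3) by auto
  have "BS k L M \<le> card (V - U) + k"
    unfolding BS_le_iff_determines[OF universe(1,2)] using U(3) by blast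
  moreover have "card (V - U) + card U = n"
    using U(1) universe by (metis card_Diff_subset card_mono finite_subset le_add_diff_inverse2)
  ultimately have "real (BS k L M) + real (card U) \<le> real n + real k" by linarith
  then show ?thesis using U(2) by simp
next
  case False
  then show ?thesis using BS_le_order[OF M, of k L] by linarith
qed

subsection \<open>Disjoint cliques\<close>

text \<open>A binary relation is presented as a \<open>k\<close>-ary one that reads only the first two entries, so
  that one symbol of arity \<open>k\<close> suffices.\<close>

definition binary_struct :: "'a set \<Rightarrow> ('a \<Rightarrow> 'a \<Rightarrow> bool) \<Rightarrow> 'a struct" where
  "binary_struct V E = \<lparr>universe = V, rel = (\<lambda>i w. E (w ! 0) (w ! 1))\<rparr>"

lemma universe_binary_struct [simp]: "universe (binary_struct V E) = V"
  by (simp add: binary_struct_def)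

lemma partial_embedding_binary_struct_iff:
  assumes "k \<ge> 2"
  shows "partial_embedding [k] (binary_struct V E) (binary_struct V' E') D f \<longleftrightarrow>
    inj_on f D \<and> f ` D \<subseteq> V' \<and> (\<forall>a \<in> D. \<forall>b \<in> D. E a b \<longleftrightarrow> E' (f a) (f b))"
proof -
  obtain j where j: "k = Suc (Suc j)" using assms by (metis add_2_eq_Suc le_Suc_ex)
  have "(\<forall>w. length w = k \<and> set w \<subseteq> D \<longrightarrow> (E (w ! 0) (w ! 1) \<longleftrightarrow> E' (map f w ! 0) (map f w ! 1))) \<longleftrightarrow>
      (\<forall>a \<in> D. \<forall>b \<in> D. E a b \<longleftrightarrow> E' (f a) (f b))" (is "?words \<longleftrightarrow> ?pairs")
  proof
    assume ?words
    show ?pairs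
    proof (intro ballI)
      fix a b assume "a \<in> D" "b \<in> D"
      then show "E a b \<longleftrightarrow> E' (f a) (f b)"
        using \<open>?words\<close>[rule_format, of "a # b # replicate j a"] j
        by (simp add: set_replicate_conv_if)
    qed
  next
    assume ?pairs
    then show ?words using j by (auto simp: subset_iff)
  qed
  then show ?thesis by (simp add: partial_embedding_def binary_struct_def)
qed

lemma isomorphic_binary_struct_regular:
  assumes "isomorphic [k] (binary_struct V E) (binary_struct V' E')" "k \<ge> 2"
    and regular: "\<And>a. a \<in> V \<Longrightarrow> card {b \<in> V. E a b} = m" and "a' \<in> V'"
  shows "card {b \<in> V'. E' a' b} = m"
proof -
  obtain f where f: "inj_on f V" "f ` V = V'" "\<forall>a \<in> V. \<forall>b \<in> V. E a b \<longleftrightarrow> E' (f a) (f b)"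
    using assms(1) unfolding isomorphic_iff_partial_embedding
    by (auto simp: partial_embedding_binary_struct_iff[OF assms(2)])
  obtain a where a: "a \<in> V" "a' = f a" using assms(4) f(2) by blast
  have "{b \<in> V'. E' a' b} = f ` {b \<in> V. E a b}" using f(2,3) a by auto
  then show ?thesis using f(1) regular[OF a(1)] by (simp add: card_image inj_on_subset)
qed

lemma locally_embeds_recolour:
  assumes "k \<ge> 2" "S \<subseteq> V" "v \<in> V - S" "d \<noteq> c v" and many: "r \<le> card {b \<in> V - S. c b = d}"
  shows "locally_embeds [k] r S id (binary_struct V (\<lambda>a b. (c(v := d)) a = (c(v := d)) b))
    (binary_struct V (\<lambda>a b. c a = c b))"
  unfolding locally_embeds_def partial_embedding_binary_struct_iff[OF assms(1)]
proof (intro allI impI, elim conjE)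
  fix B assume B: "finite B" "B \<subseteq> universe (binary_struct V (\<lambda>a b. (c(v := d)) a = (c(v := d)) b))"
    "card B \<le> r"
  show "\<exists>\<theta>. (inj_on \<theta> (S \<union> B) \<and> \<theta> ` (S \<union> B) \<subseteq> V \<and>
      (\<forall>a \<in> S \<union> B. \<forall>b \<in> S \<union> B. ((c(v := d)) a = (c(v := d)) b) = (c (\<theta> a) = c (\<theta> b)))) \<and>
      (\<forall>x \<in> S. \<theta> x = id x)"
  proof (cases "v \<in> B")
    case True
    have "card (B - {v}) < r" using True B(1,3) by (meson card_Diff1_less less_le_trans)
    then have "\<not> {b \<in> V - S. c b = d} \<subseteq> B - {v}"
      using many B(1) card_mono[of "B - {v}" "{b \<in> V - S. c b = d}"] by auto
    then obtain w where w: "w \<in> V - S" "c w = d" "w \<notin> B" using \<open>d \<noteq> c v\<close> by auto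
    have "inj_on (id(v := w)) (S \<union> B)" using w by (auto simp: inj_on_def)
    moreover have "id(v := w) ` (S \<union> B) \<subseteq> V" using w B(2) \<open>S \<subseteq> V\<close> by auto
    moreover have "(c(v := d)) x = c ((id(v := w)) x)" for x using w(2) by simp
    ultimately show ?thesis using assms(3) by (intro exI[of _ "id(v := w)"]) auto
  next
    case False
    then show ?thesis using B(2) assms(2,3) by (intro exI[of _ id]) auto
  qed
qed

lemma locally_embeds_change_edge:
  assumes "k \<ge> 2" "S \<subseteq> V" "v \<notin> S" "w \<notin> S" "v \<noteq> w" "r \<le> 1"
    and E': "\<And>a b. {a, b} \<noteq> {v, w} \<Longrightarrow> E' a b \<longleftrightarrow> E a b"
  shows "locally_embeds [k] r S id (binary_struct V E') (binary_struct V E)"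
  unfolding locally_embeds_def partial_embedding_binary_struct_iff[OF assms(1)]
proof (intro allI impI exI[of _ id] conjI ballI; (elim conjE)?)
  fix B a b assume B: "finite B" "card B \<le> r" and ab: "a \<in> S \<union> B" "b \<in> S \<union> B"
  have "\<not> {v, w} \<subseteq> B"
  proof
    assume "{v, w} \<subseteq> B"
    then have "card {v, w} \<le> card B" using B(1) by (rule card_mono[rotated])
    then show False using B(2) \<open>r \<le> 1\<close> \<open>v \<noteq> w\<close> by simp
  qed
  then have "\<not> {v, w} \<subseteq> S \<union> B" using \<open>v \<notin> S\<close> \<open>w \<notin> S\<close> by auto
  moreover have "{a, b} \<subseteq> S \<union> B" using ab by simp
  ultimately have "{a, b} \<noteq> {v, w}" by metis
  then show "E' a b \<longleftrightarrow> E (id a) (id b)" using E' by simp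
qed (use assms(2) in auto)

locale equipartition =
  fixes V :: "'a set" and c :: "'a \<Rightarrow> 'b" and m :: nat
  assumes finite_V: "finite V" and card_part: "d \<in> c ` V \<Longrightarrow> card {b \<in> V. c b = d} = m"
begin

definition cliques :: "'a struct" where
  "cliques = binary_struct V (\<lambda>a b. c a = c b)"

lemma universe_cliques [simp]: "universe cliques = V"
  by (simp add: cliques_def)

context
  fixes k :: nat
  assumes k_ge_2: "k \<ge> 2"
begin

lemma degree_if_locally_embeds:
  assumes det: "determines [k] r cliques S"
    and "locally_embeds [k] r S id (binary_struct V E) cliques" "a \<in> V"
  shows "card {b \<in> V. E a b} = m"
proof -
  have "S \<subseteq> V" using det by (simp add: determines_def)
  have "isomorphic [k] cliques (binary_struct V E)"
    using det[unfolded determines_def, THEN conjunct2, rule_format, of "binary_struct V E" S id]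
      \<open>S \<subseteq> V\<close> assms(2) finite_V by (simp add: has_order_def)
  then show ?thesis
    unfolding cliques_def
  proof (rule isomorphic_binary_struct_regular[OF _ k_ge_2 _ \<open>a \<in> V\<close>])
    show "card {b \<in> V. c a = c b} = m" if "a \<in> V" for a
      using card_part[of "c a"] that by (simp add: eq_commute)
  qed
qed

lemma card_unnamed_of_other_colour_less:
  assumes det: "determines [k] r cliques S" and v: "v \<in> V - S" and d: "d \<in> c ` V" "d \<noteq> c v"
  shows "card {b \<in> V - S. c b = d} < r"
proof (rule ccontr)
  assume "\<not> card {b \<in> V - S. c b = d} < r"
  then have "locally_embeds [k] r S id
      (binary_struct V (\<lambda>a b. (c(v := d)) a = (c(v := d)) b)) cliques"
    using det v d(2) unfolding cliques_def
    by (intro locally_embeds_recolour[OF k_ge_2]) (auto simp: determines_def)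
  note degree = degree_if_locally_embeds[OF det this]
  obtain w where w: "w \<in> V" "c w = d" using d(1) by blast
  have "card {b \<in> V. (c(v := d)) w = (c(v := d)) b} = m" using w(1) by (rule degree)
  moreover have "{b \<in> V. (c(v := d)) w = (c(v := d)) b} = insert v {b \<in> V. c b = d}"
    using v w d(2) by auto
  ultimately show False using card_part[OF d(1)] finite_V d(2) by simp
qed

lemma unnamed_colours_distinct:
  assumes det: "determines [k] r cliques S" and "r \<le> 1" and vw: "v \<in> V - S" "w \<in> V - S" "v \<noteq> w"
  shows "c v \<noteq> c w"
proof
  assume same: "c v = c w"
  define E where "E a b \<longleftrightarrow> c a = c b \<and> {a, b} \<noteq> {v, w}" for a b
  have "locally_embeds [k] r S id (binary_struct V E) cliques"
    using det vw \<open>r \<le> 1\<close> unfolding cliques_def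
    by (intro locally_embeds_change_edge[OF k_ge_2, of _ _ v w]) (auto simp: determines_def E_def)
  then have "card {b \<in> V. E v b} = m"
    by (rule degree_if_locally_embeds[OF det]) (use vw in blast)
  moreover have "{b \<in> V. E v b} \<subset> {b \<in> V. c b = c v}" using same vw by (auto simp: E_def)
  then have "card {b \<in> V. E v b} < card {b \<in> V. c b = c v}"
    using finite_V by (intro psubset_card_mono) auto
  ultimately show False using card_part[of "c v"] vw(1) by simp
qed

lemma card_unnamed_le_if_le_1:
  assumes det: "determines [k] r cliques S" and "r \<le> 1" and "card (c ` V) \<ge> 2"
  shows "card (V - S) \<le> r"
proof (cases "r = 0")
  case True
  have "v \<notin> V - S" for v
  proof
    assume v: "v \<in> V - S"
    have "\<not> c ` V \<subseteq> {c v}" using assms(3) card_mono[of "{c v}" "c ` V"] by auto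
    then obtain d where "d \<in> c ` V" "d \<noteq> c v" by blast
    then show False using card_unnamed_of_other_colour_less[OF det v] True by blast
  qed
  then show ?thesis by (metis card.empty ex_in_conv le0)
next
  case False
  have "v = w" if vw: "v \<in> V - S" "w \<in> V - S" for v w
  proof (rule ccontr)
    assume "v \<noteq> w"
    then have "c w \<noteq> c v" using unnamed_colours_distinct[OF det \<open>r \<le> 1\<close>] vw by metis
    then have "card {b \<in> V - S. c b = c w} < r"
      using card_unnamed_of_other_colour_less[OF det vw(1)] vw(2) by blast
    then have "card {b \<in> V - S. c b = c w} = 0" using \<open>r \<le> 1\<close> by linarith
    then show False using vw(2) finite_V by auto
  qed
  then have "card (V - S) \<le> Suc 0" using finite_V by (simp add: card_le_Suc0_iff_eq)
  then show ?thesis using False by simp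
qed

lemma card_unnamed_le:
  assumes det: "determines [k] r cliques S" and "r \<ge> 1"
  shows "card (V - S) \<le> max m ((r - 1) * card (c ` V))"
proof (cases "\<forall>v \<in> V - S. \<forall>w \<in> V - S. c v = c w")
  case True
  then show ?thesis
  proof (cases "V - S = {}")
    case False
    then obtain v where v: "v \<in> V - S" by blast
    then have "V - S \<subseteq> {b \<in> V. c b = c v}" using True by blast
    then have "card (V - S) \<le> card {b \<in> V. c b = c v}" using finite_V by (intro card_mono) auto
    then show ?thesis using card_part[of "c v"] v by simp
  qed (metis card.empty le0)
next
  case False
  then obtain v w where vw: "v \<in> V - S" "w \<in> V - S" "c v \<noteq> c w" by blast
  have small: "card (c -` {d} \<inter> (V - S)) \<le> r - 1" if "d \<in> c ` V" for d
  proof -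
    obtain x where "x \<in> V - S" "d \<noteq> c x" using vw by metis
    then have "card {b \<in> V - S. c b = d} < r"
      using card_unnamed_of_other_colour_less[OF det] that by blast
    moreover have "c -` {d} \<inter> (V - S) = {b \<in> V - S. c b = d}" by auto
    ultimately show ?thesis by simp
  qed
  have "c \<in> V - S \<rightarrow> c ` V" "c ` V \<noteq> {}" using vw(1) by auto
  then obtain d where "d \<in> c ` V" "card (V - S) \<le> card (c -` {d} \<inter> (V - S)) * card (c ` V)"
    using pigeonhole_card[of c "V - S" "c ` V"] finite_V by blast
  then show ?thesis using small by (meson le_trans max.coboundedI2 mult_le_mono1)
qed

lemma card_unnamed_add_le:
  assumes det: "determines [k] r cliques S" and q: "r \<le> q" "q \<ge> 2"
    and l: "card (c ` V) \<ge> 2" "m \<le> card (c ` V)"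
  shows "card (V - S) + q \<le> r + (q - 1) * card (c ` V)"
proof (cases "r \<le> 1")
  case True
  have "q \<le> (q - 1) * 2" using q(2) by simp
  also have "\<dots> \<le> (q - 1) * card (c ` V)" using l(1) by (rule mult_le_mono2)
  finally show ?thesis using card_unnamed_le_if_le_1[OF det True l(1)] by simp
next
  case False
  then have "1 * card (c ` V) \<le> (r - 1) * card (c ` V)" by (intro mult_le_mono1) simp
  moreover have "card (V - S) \<le> max m ((r - 1) * card (c ` V))"
    by (rule card_unnamed_le[OF det]) (use False in simp)
  ultimately have "card (V - S) \<le> (r - 1) * card (c ` V)" using l(2) by linarith
  moreover have "(r - 1) * card (c ` V) + (q - r) \<le> (r - 1) * card (c ` V) + (q - r) * card (c ` V)"
    using l(1) by simp
  moreover have "(r - 1) * card (c ` V) + (q - r) * card (c ` V) = (q - 1) * card (c ` V)"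
    using False q(1) by (simp flip: add_mult_distrib)
  ultimately show ?thesis using q(1) by linarith
qed

end

end

lemma BS_cliques_ge:
  fixes V :: "nat set"
  assumes "equipartition V c m" "k \<ge> 2" "q \<ge> 2" "card (c ` V) \<ge> 2" "m \<le> card (c ` V)"
  shows "card V + q \<le> BS q [k] (equipartition.cliques V c) + (q - 1) * card (c ` V)"
proof -
  interpret equipartition V c m by (rule assms(1))
  have "finite (universe cliques)" "universe cliques \<noteq> {}" using finite_V assms(4) by auto
  from BS_le_iff_determines[OF this] obtain r S where
    S: "r \<le> q" "card S + r \<le> BS q [k] cliques" "determines [k] r cliques S"
    by blast
  have "S \<subseteq> V" using S(3) by (simp add: determines_def)
  then have "card V = card S + card (V - S)"
    using finite_V by (metis card_Diff_subset card_mono finite_subset le_add_diff_inverse)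
  then show ?thesis using card_unnamed_add_le[OF assms(2) S(3,1) assms(3-)] S(2) by linarith
qed

lemma div_fibre_lessThan:
  fixes m d :: nat
  assumes "d < l"
  shows "{b \<in> {..<l * m}. b div m = d} = {d * m..<Suc d * m}"
proof (intro equalityI subsetI)
  fix b assume b: "b \<in> {d * m..<Suc d * m}"
  then have "b div m = d" by (intro div_nat_eqI) (auto simp: mult.commute)
  moreover have "Suc d * m \<le> l * m" using assms by (intro mult_le_mono1) simp
  ultimately show "b \<in> {b \<in> {..<l * m}. b div m = d}" using b by auto
qed (cases "m = 0"; auto simp: dividend_less_times_div mult.commute)

lemma image_div_lessThan:
  fixes l m :: nat
  assumes "m > 0"
  shows "(\<lambda>b. b div m) ` {..<l * m} = {..<l}"
proof (intro equalityI subsetI)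
  fix d assume "d \<in> {..<l}"
  then show "d \<in> (\<lambda>b. b div m) ` {..<l * m}" using assms by (intro image_eqI[of _ _ "d * m"]) auto
qed (auto simp: less_mult_imp_div_less)

lemma ex_structure_BS_ge:
  assumes "q \<ge> 2" "k \<ge> 2" "m \<ge> 2"
  shows "\<exists>M :: nat struct. has_order M (m\<^sup>2) \<and> m\<^sup>2 + q \<le> BS q [k] M + (q - 1) * m"
proof -
  let ?V = "{..<m * m}" and ?c = "\<lambda>b. b div m"
  have image: "?c ` ?V = {..<m}" using assms(3) by (intro image_div_lessThan) simp
  interpret equipartition ?V ?c m
  proof
    show "card {b \<in> ?V. b div m = d} = m" if "d \<in> ?c ` ?V" for d
      using that unfolding image by (subst div_fibre_lessThan) auto
  qed simp
  have "card ?V + q \<le> BS q [k] cliques + (q - 1) * card (?c ` ?V)"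
    by (rule BS_cliques_ge[OF equipartition_axioms]) (use assms image in auto)
  then show ?thesis
    using image by (intro exI[of _ cliques]) (simp add: has_order_def power2_eq_square)
qed

subsection \<open>The maximum over all structures\<close>

lemma finite_BS_values:
  assumes "n \<ge> 1"
  shows "finite {BS q L M | L (M :: nat struct).
    vocabulary L \<and> has_max_arity L k \<and> has_order M n}"
  by (rule finite_subset[of _ "{..n}"]) (auto intro: BS_le_order[OF _ assms])

lemma singleton_vocabulary:
  "k \<ge> 1 \<Longrightarrow> vocabulary [k] \<and> has_max_arity [k] k"
  by (simp add: vocabulary_def has_max_arity_def)

lemma BS_le_BS_max:
  fixes M :: "nat struct"
  assumes "n \<ge> 1" "k \<ge> 1" "has_order M n"
  shows "BS q [k] M \<le> BS_max q n k"
  unfolding BS_max_def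
  using assms(3) singleton_vocabulary[OF assms(2)] by (intro Max_ge finite_BS_values assms(1)) blast

lemma BS_max_attained:
  assumes "n \<ge> 1" "k \<ge> 1"
  obtains L and M :: "nat struct"
  where "has_max_arity L k" "has_order M n" "BS_max q n k = BS q L M"
proof -
  let ?A = "{BS q L M | L (M :: nat struct). vocabulary L \<and> has_max_arity L k \<and> has_order M n}"
  have "has_order (binary_struct {..<n} (=)) n" by (simp add: has_order_def)
  then have "?A \<noteq> {}" using singleton_vocabulary[OF assms(2)] by blast
  then have "BS_max q n k \<in> ?A" unfolding BS_max_def by (intro Max_in finite_BS_values assms(1))
  then show ?thesis using that by blast
qed

lemma BS_max_less:
  assumes "n \<ge> 1" "k \<ge> 1" "k \<ge> 2 \<or> n < 4"
  shows "real (BS_max k n k) < real n - sqrt n + real k ^ 2 + real k"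
proof -
  obtain L and M :: "nat struct" where M: "has_max_arity L k" "has_order M n"
    "BS_max k n k = BS k L M"
    using BS_max_attained[OF assms(1,2)] .
  show ?thesis
  proof (cases "k \<ge> 2")
    case True
    then show ?thesis using BS_less[OF M(1,2) assms(1)] M(3) by simp
  next
    case False
    then have "k = 1" "n < 4" using assms(2,3) by auto
    moreover from this have "sqrt n < sqrt 4" by (subst real_sqrt_less_iff) simp
    moreover have "BS k L M \<le> n" by (rule BS_le_order[OF M(2) assms(1)])
    ultimately show ?thesis using M(3) by simp
  qed
qed

lemma BS_max_ge:
  assumes "q \<ge> 2" "k \<ge> 2" "m \<ge> 2"
  shows "real (BS_max q (m\<^sup>2) k) \<ge> real (m\<^sup>2) - (real q - 1) * real m + real q"
proof -
  obtain M :: "nat struct" where M: "has_order M (m\<^sup>2)" "m\<^sup>2 + q \<le> BS q [k] M + (q - 1) * m"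
    using ex_structure_BS_ge[OF assms] by blast
  then have "m\<^sup>2 + q \<le> BS_max q (m\<^sup>2) k + (q - 1) * m"
    using BS_le_BS_max[OF _ _ M(1), of k q] assms by fastforce
  then have "real (m\<^sup>2 + q) \<le> real (BS_max q (m\<^sup>2) k + (q - 1) * m)" by (simp only: of_nat_le_iff)
  then show ?thesis using assms(1) by (simp add: of_nat_diff)
qed

theorem theorem6p2:
  fixes n k :: nat
  assumes "n \<ge> 1" and "k \<ge> 1"
  shows "(k \<ge> 2 \<or> n < 4 \<longrightarrow>
            real (BS_max k n k) < real n - sqrt (real n) + real k ^ 2 + real k) \<and>
         (\<forall>q :: nat. q \<ge> 2 \<and> k \<ge> 2 \<and> n > 1 \<and> (\<exists>m :: nat. n = m ^ 2) \<longrightarrow>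
            real (BS_max q n k) \<ge> real n - (real q - 1) * sqrt (real n) + real q)"
proof (intro conjI impI allI)
  assume "k \<ge> 2 \<or> n < 4"
  with assms show "real (BS_max k n k) < real n - sqrt (real n) + real k ^ 2 + real k"
    by (rule BS_max_less)
next
  fix q :: nat
  assume "q \<ge> 2 \<and> k \<ge> 2 \<and> n > 1 \<and> (\<exists>m :: nat. n = m ^ 2)"
  then obtain m :: nat where q: "q \<ge> 2" "k \<ge> 2" and n: "n > 1" "n = m\<^sup>2" by blast
  have "m \<ge> 2" using n by (cases "m = 0 \<or> m = 1") auto
  moreover have "sqrt n = m" using n(2) by simp
  ultimately show "real (BS_max q n k) \<ge> real n - (real q - 1) * sqrt (real n) + real q"
    using BS_max_ge[OF q, of m] n(2) by simp
qed

end
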